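(* Any Banach space with a projectional skeleton admits a strong Markushevich basis.
   Context: Banach spaces are real or complex. A projectional skeleton on a Banach space $X$ is a family $(P_s)_{s\in\Gamma}$ of bounded linear projections on $X$ indexed by an up-directed partially ordered set $\Gamma$ such that: (i) $P_sX$ is separable for $s\in\Gamma$; (ii) $P_sP_t=P_tP_s=P_s$ whenever $s\le t$; (iii) if $(s_n)$ is an increasing (i.e. non-decreasing) sequence in $\Gamma$, then $s=\sup_n s_n$ exists in $\Gamma$ and $P_sX=\overline{\bigcup_nP_{s_n}X}$; (iv) $X=\bigcup_{s\in\Gamma}P_sX$. A Markushevich basis of $X$ is an indexed family $(x_\alpha,x_\alpha^* )_{\alpha\in\Lambda}$ in $X\times X^*$ such that $x_\alpha^*(x_\alpha)=1$ and $x_\alpha^*(x_\beta)=0$ for $\alpha\ne\beta$; $\overline{\operatorname{span}}\{x_\alpha:\alpha\in\Lambda\}=X$; and $\{x_\alpha^*:\alpha\in\Lambda\}$ separates points of $X$. It is strong if $x\in\overline{\operatorname{span}}\{x_\alpha:\alpha\in\Lambda,\ x_\alpha^*(x)\neq0\}$ for every $x\in X$. *)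

theory Defs
  imports "HOL-Analysis.Analysis"
begin

text \<open>
  A Banach space over the scalar field \<open>'k\<close> (below, real or complex) is a type of class \<open>banach\<close>
  with a scalar multiplication by \<open>'k\<close> that extends its real scalar multiplication and is
  compatible with its norm. For real scalars this forces the multiplication to be \<open>scaleR\<close>.
\<close>

locale banach_space_over = vector_space smul
  for smul :: "'k::real_normed_field \<Rightarrow> 'a::banach \<Rightarrow> 'a" +
  assumes smul_of_real: "smul (of_real r) x = r *\<^sub>R x"
    and norm_smul: "norm (smul c x) = norm c * norm x"

lemma banach_space_over_scaleR:
  "banach_space_over (scaleR :: real \<Rightarrow> 'a::banach \<Rightarrow> 'a)"
  by (intro banach_space_over.intro banach_space_over_axioms.intro)
    (auto simp: real_vector.vector_space_axioms)

lemma banach_space_over_complex_mult: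
  "banach_space_over ((*) :: complex \<Rightarrow> complex \<Rightarrow> complex)"
  by (intro banach_space_over.intro banach_space_over_axioms.intro vector_space_over_itself.vector_space_axioms)
    (auto simp: scaleR_conv_of_real norm_mult)

text \<open>Boundedness is stated as in the library locale \<open>bounded_linear\<close>, which covers real
  scalars only.\<close>

definition bounded_linear_over ::
  "('k::real_normed_field \<Rightarrow> 'a::real_normed_vector \<Rightarrow> 'a) \<Rightarrow>
   ('k \<Rightarrow> 'b::real_normed_vector \<Rightarrow> 'b) \<Rightarrow> ('a \<Rightarrow> 'b) \<Rightarrow> bool" where
  "bounded_linear_over s1 s2 f \<longleftrightarrow>
     Vector_Spaces.linear s1 s2 f \<and> (\<exists>K. \<forall>x. norm (f x) \<le> norm x * K)"

definition dual_space ::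
  "('k::real_normed_field \<Rightarrow> 'a::real_normed_vector \<Rightarrow> 'a) \<Rightarrow> ('a \<Rightarrow> 'k) set" where
  "dual_space smul = {f. bounded_linear_over smul (*) f}"

definition separable_set :: "'a::topological_space set \<Rightarrow> bool" where
  "separable_set S \<longleftrightarrow> (\<exists>T. countable T \<and> T \<subseteq> S \<and> S \<subseteq> closure T)"

definition up_directed_on :: "'s set \<Rightarrow> 's rel \<Rightarrow> bool" where
  "up_directed_on \<Gamma> le \<longleftrightarrow>
     \<Gamma> \<noteq> {} \<and> (\<forall>s\<in>\<Gamma>. \<forall>t\<in>\<Gamma>. \<exists>u\<in>\<Gamma>. (s, u) \<in> le \<and> (t, u) \<in> le)"

definition is_lub_on :: "'s set \<Rightarrow> 's rel \<Rightarrow> 's set \<Rightarrow> 's \<Rightarrow> bool" where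
  "is_lub_on \<Gamma> le A s \<longleftrightarrow>
     s \<in> \<Gamma> \<and> (\<forall>a\<in>A. (a, s) \<in> le) \<and>
     (\<forall>u\<in>\<Gamma>. (\<forall>a\<in>A. (a, u) \<in> le) \<longrightarrow> (s, u) \<in> le)"

definition projectional_skeleton ::
  "('k::real_normed_field \<Rightarrow> 'a::banach \<Rightarrow> 'a) \<Rightarrow> 's set \<Rightarrow> 's rel \<Rightarrow> ('s \<Rightarrow> 'a \<Rightarrow> 'a) \<Rightarrow> bool" where
  "projectional_skeleton smul \<Gamma> le P \<longleftrightarrow>
     partial_order_on \<Gamma> le \<and> up_directed_on \<Gamma> le \<and>
     (\<forall>s\<in>\<Gamma>. bounded_linear_over smul smul (P s) \<and> P s \<circ> P s = P s) \<and>
     (\<forall>s\<in>\<Gamma>. separable_set (range (P s))) \<and>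
     (\<forall>s\<in>\<Gamma>. \<forall>t\<in>\<Gamma>. (s, t) \<in> le \<longrightarrow> P s \<circ> P t = P s \<and> P t \<circ> P s = P s) \<and>
     (\<forall>\<sigma> :: nat \<Rightarrow> 's. (\<forall>n. \<sigma> n \<in> \<Gamma>) \<and> (\<forall>n. (\<sigma> n, \<sigma> (Suc n)) \<in> le) \<longrightarrow>
        (\<exists>s. is_lub_on \<Gamma> le (range \<sigma>) s \<and> range (P s) = closure (\<Union>n. range (P (\<sigma> n))))) \<and>
     (\<Union>s\<in>\<Gamma>. range (P s)) = UNIV"

definition markushevich_basis ::
  "('k::real_normed_field \<Rightarrow> 'a::banach \<Rightarrow> 'a) \<Rightarrow> 'i set \<Rightarrow> ('i \<Rightarrow> 'a) \<Rightarrow> ('i \<Rightarrow> 'a \<Rightarrow> 'k) \<Rightarrow> bool" where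
  "markushevich_basis smul \<Lambda> e f \<longleftrightarrow>
     (\<forall>\<alpha>\<in>\<Lambda>. f \<alpha> \<in> dual_space smul) \<and>
     (\<forall>\<alpha>\<in>\<Lambda>. f \<alpha> (e \<alpha>) = 1) \<and>
     (\<forall>\<alpha>\<in>\<Lambda>. \<forall>\<beta>\<in>\<Lambda>. \<alpha> \<noteq> \<beta> \<longrightarrow> f \<alpha> (e \<beta>) = 0) \<and>
     closure (module.span smul (e ` \<Lambda>)) = UNIV \<and>
     (\<forall>x y. x \<noteq> y \<longrightarrow> (\<exists>\<alpha>\<in>\<Lambda>. f \<alpha> x \<noteq> f \<alpha> y))"

definition strong_markushevich_basis ::
  "('k::real_normed_field \<Rightarrow> 'a::banach \<Rightarrow> 'a) \<Rightarrow> 'i set \<Rightarrow> ('i \<Rightarrow> 'a) \<Rightarrow> ('i \<Rightarrow> 'a \<Rightarrow> 'k) \<Rightarrow> bool" where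
  "strong_markushevich_basis smul \<Lambda> e f \<longleftrightarrow>
     markushevich_basis smul \<Lambda> e f \<and>
     (\<forall>x. x \<in> closure (module.span smul (e ` {\<alpha>\<in>\<Lambda>. f \<alpha> x \<noteq> 0})))"

text \<open>The vectors of a Markushevich basis are pairwise distinct, so the basis can always be indexed
  by a set of vectors of the space; indexing by \<open>'a\<close> is therefore no restriction.\<close>

definition admits_strong_markushevich_basis ::
  "('k::real_normed_field \<Rightarrow> 'a::banach \<Rightarrow> 'a) \<Rightarrow> bool" where
  "admits_strong_markushevich_basis smul \<longleftrightarrow>
     (\<exists>(\<Lambda> :: 'a set) e f. strong_markushevich_basis smul \<Lambda> e f)"

lemma markushevich_basis_inj_on:
  assumes "markushevich_basis smul \<Lambda> e f"
  shows "inj_on e \<Lambda>"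
proof (rule inj_onI, rule ccontr)
  fix \<alpha> \<beta> assume "\<alpha> \<in> \<Lambda>" "\<beta> \<in> \<Lambda>" "e \<alpha> = e \<beta>" "\<alpha> \<noteq> \<beta>"
  with assms have "f \<alpha> (e \<beta>) = 1" "f \<alpha> (e \<beta>) = 0"
    unfolding markushevich_basis_def by metis+
  then show False by simp
qed

end

theory Submission
  imports Defs
begin

text \<open>
  Let \<open>(e, f)\<close> run through a biorthogonal system whose vectors span a dense subspace. By the
  Hahn-Banach theorem the system is a strong Markushevich basis as soon as \<open>g x = 0\<close> for every
  vector \<open>x\<close> and bounded functional \<open>g\<close> such that \<open>f x * g e = 0\<close> for all its pairs: if \<open>x\<close> were
  outside the closed span of the \<open>e\<close> with \<open>f x \<noteq> 0\<close>, a functional vanishing on these \<open>e\<close> but not at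
  \<open>x\<close> would violate this. Everything is arranged so that such pairs \<open>x\<close>, \<open>g\<close> can be controlled.

  \<^bold>\<open>Separable spaces.\<close> A skeleton on a separable space may consist of the identity alone, so
  the theorem contains Terenzi's theorem that separable Banach spaces have strong Markushevich
  bases. The basis is built by finite blocks. Write \<open>S\<close> for the expansion operator of the finite
  system \<open>B\<close> reached so far. The point is to find a finite biorthogonal extension \<open>D\<close> of \<open>B\<close> for
  which \<open>f z * g e = 0\<close> for all pairs in \<open>D - B\<close> forces \<open>norm (g (S z)) \<le> 3 * norm z\<close>
  whenever \<open>norm g \<le> 1\<close>; the constant 3 does not depend on \<open>B\<close>
  (\<open>bounded_extension\<close>). If \<open>y\<close> is in the span of \<open>B\<close> and close to \<open>x\<close>, this applied to
  \<open>z = x - y\<close>, together with \<open>g (S x) = 0\<close> and \<open>g y = - g (S z)\<close>, gives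
  \<open>norm (g x) \<le> 4 * norm (x - y)\<close>, hence \<open>g x = 0\<close> in the limit (\<open>strong_system_separable\<close>).

  To build \<open>D\<close>, add to \<open>B\<close> finitely many pairs \<open>(e, f)\<close>, forming a set \<open>K\<close>, whose vectors together
  with those of \<open>B\<close> span a finite net of the unit ball as seen through \<open>S\<close>. If \<open>g\<close> is tiny on
  every vector of \<open>K\<close>, then \<open>g (S z)\<close> is almost \<open>g\<close> of a net element, so it is bounded. To deal with the other case,
  each \<open>(e, f)\<close> in \<open>K\<close> receives its own finite set \<open>A\<close> of further pairs \<open>(v, \<phi>)\<close> such that
  the vanishing of all \<open>\<phi>\<close> at \<open>z\<close> bounds \<open>g\<close> on the expansion of \<open>z\<close> with
  respect to the whole current system; these \<open>\<phi>\<close> come from a finite net of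
  functionals. Then \<open>(e, f)\<close> and \<open>A\<close> are coupled: \<open>v\<close> becomes \<open>v + a e\<close> with a
  huge number \<open>a\<close>, and \<open>f\<close> becomes \<open>f\<close> minus \<open>a\<close> times the sum of the \<open>\<phi>\<close>. If some \<open>\<phi> z\<close> is
  nonzero, \<open>g (v + a e) = 0\<close> makes \<open>g e\<close> tiny. Otherwise all \<open>\<phi>\<close> vanish at \<open>z\<close>, the change of \<open>f\<close>
  is invisible there, and for the last coupled pair of this kind the terms of \<open>K\<close> in the
  expansion either have zero products or are tiny (\<open>perturbed_extension\<close>).

  \<^bold>\<open>The general case.\<close> Some cofinal part of the skeleton is uniformly bounded. For an index set
  \<open>A\<close> closed under a choice \<open>ub\<close> of upper bounds the projections \<open>P s\<close> with \<open>s \<in> A\<close>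
  converge pointwise to a projection \<open>proj A\<close>, continuously along increasing unions of such sets.
  The key identity is that \<open>proj A\<close> after \<open>proj M\<close> is \<open>proj (M \<inter> A)\<close> whenever \<open>M\<close> is closed under certain
  countably many operations attached to \<open>A\<close> (\<open>proj_Int_operations\<close>). This makes an induction on
  the cardinality of the index set possible (\<open>strong_system_exists\<close>): an uncountable index set is
  the union of a well-ordered chain of smaller closed sets, the differences of consecutive
  projections again have an invariant family of projections, indexed by the sets closed under a
  larger but still countable family of operations, and the union of the strong systems of all the
  differences is a strong system, because every \<open>x\<close> lies in the closed span of its images under the differences.
  Countable index sets give separable ranges, where the first part applies.
\<close>

section \<open>The Hahn-Banach theorem\<close>

definition sublinear :: "('a::real_vector \<Rightarrow> real) \<Rightarrow> bool" where
  "sublinear q \<longleftrightarrow> (\<forall>x y. q (x + y) \<le> q x + q y) \<and> (\<forall>t>0. \<forall>x. q (t *\<^sub>R x) \<le> t * q x)"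

lemma sublinear_add: "sublinear q \<Longrightarrow> q (x + y) \<le> q x + q y"
  and sublinear_scale_le: "sublinear q \<Longrightarrow> t > 0 \<Longrightarrow> q (t *\<^sub>R x) \<le> t * q x"
  by (auto simp: sublinear_def)

lemma sublinear_zero:
  assumes "sublinear q" shows "q 0 = 0"
proof -
  have "q 0 \<le> 2 * q 0" "q 0 \<le> (1/2) * q 0"
    using sublinear_scale_le[OF assms, of 2 0] sublinear_scale_le[OF assms, of "1/2" 0] by auto
  then show ?thesis by linarith
qed

lemma sublinear_scale:
  assumes q: "sublinear q" and "t \<ge> 0" shows "q (t *\<^sub>R x) = t * q x"
proof (cases "t = 0")
  case True then show ?thesis using sublinear_zero[OF q] by simp
next
  case False
  then have t: "t > 0" using assms by simp
  have "q ((1/t) *\<^sub>R (t *\<^sub>R x)) \<le> (1/t) * q (t *\<^sub>R x)"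
    by (rule sublinear_scale_le[OF q]) (use t in simp)
  then have "t * q x \<le> q (t *\<^sub>R x)" using t by (simp add: field_simps)
  then show ?thesis using sublinear_scale_le[OF q t, of x] by simp
qed

lemma sublinear_lower:
  assumes "sublinear q" shows "- q (- x) \<le> q x"
  using sublinear_add[OF assms, of x "- x"] sublinear_zero[OF assms] by simp

text \<open>
  The largest sublinear functional below the sublinear functional \<open>q\<close> that takes the value
  \<open>- q y\<close> at \<open>- y\<close>.
\<close>

definition anchored :: "('a::real_vector \<Rightarrow> real) \<Rightarrow> 'a \<Rightarrow> 'a \<Rightarrow> real" where
  "anchored q y x = (INF t\<in>{0..}. q (x + t *\<^sub>R y) - t * q y)"

lemma anchored_le:
  assumes q: "sublinear q" and t: "t \<ge> 0"
  shows "anchored q y x \<le> q (x + t *\<^sub>R y) - t * q y"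
  unfolding anchored_def
proof (rule cINF_lower)
  show "bdd_below ((\<lambda>t. q (x + t *\<^sub>R y) - t * q y) ` {0..})"
  proof (rule bdd_belowI2)
    fix t :: real assume "t \<in> {0..}"
    then have "t * q y = q (- x + (x + t *\<^sub>R y))" using sublinear_scale[OF q] by simp
    also have "\<dots> \<le> q (- x) + q (x + t *\<^sub>R y)" by (rule sublinear_add[OF q])
    finally show "- q (- x) \<le> q (x + t *\<^sub>R y) - t * q y" by simp
  qed
qed (use t in auto)

lemma anchored_greatest:
  assumes "\<And>t. t \<ge> 0 \<Longrightarrow> c \<le> q (x + t *\<^sub>R y) - t * q y"
  shows "c \<le> anchored q y x"
  unfolding anchored_def by (rule cINF_greatest) (use assms in auto)

lemma sublinear_anchored:
  assumes q: "sublinear q" shows "sublinear (anchored q y)"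
  unfolding sublinear_def
proof (intro conjI allI impI)
  fix x x' :: 'a
  have *: "anchored q y (x + x') - (q (x' + t' *\<^sub>R y) - t' * q y) \<le> q (x + t *\<^sub>R y) - t * q y"
    if "t \<ge> 0" "t' \<ge> 0" for t t'
  proof -
    have "anchored q y (x + x') \<le> q ((x + x') + (t + t') *\<^sub>R y) - (t + t') * q y"
      by (rule anchored_le[OF q]) (use that in simp)
    also have "q ((x + x') + (t + t') *\<^sub>R y) = q ((x + t *\<^sub>R y) + (x' + t' *\<^sub>R y))"
      by (simp add: algebra_simps)
    also have "\<dots> \<le> q (x + t *\<^sub>R y) + q (x' + t' *\<^sub>R y)" by (rule sublinear_add[OF q])
    finally show ?thesis by (simp add: algebra_simps)
  qed
  have "anchored q y (x + x') - anchored q y x \<le> anchored q y x'"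
  proof (rule anchored_greatest)
    fix t' :: real assume "t' \<ge> 0"
    then have "anchored q y (x + x') - (q (x' + t' *\<^sub>R y) - t' * q y) \<le> anchored q y x"
      by (intro anchored_greatest *)
    then show "anchored q y (x + x') - anchored q y x \<le> q (x' + t' *\<^sub>R y) - t' * q y" by simp
  qed
  then show "anchored q y (x + x') \<le> anchored q y x + anchored q y x'" by simp
next
  fix s :: real and x assume s: "s > 0"
  have "anchored q y (s *\<^sub>R x) / s \<le> anchored q y x"
  proof (rule anchored_greatest)
    fix t :: real assume t: "t \<ge> 0"
    have "anchored q y (s *\<^sub>R x) \<le> q (s *\<^sub>R x + (s * t) *\<^sub>R y) - (s * t) * q y"
      by (rule anchored_le[OF q]) (use s t in simp)
    also have "s *\<^sub>R x + (s * t) *\<^sub>R y = s *\<^sub>R (x + t *\<^sub>R y)" by (simp add: scaleR_add_right)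
    also have "q \<dots> = s * q (x + t *\<^sub>R y)" using sublinear_scale[OF q] s by simp
    finally show "anchored q y (s *\<^sub>R x) / s \<le> q (x + t *\<^sub>R y) - t * q y"
      using s by (simp add: field_simps)
  qed
  then show "anchored q y (s *\<^sub>R x) \<le> s * anchored q y x" using s by (simp add: field_simps)
qed

text \<open>
  Zorn's lemma applies because the pointwise infimum of a chain is finite: every sublinear \<open>q \<le> p\<close>
  satisfies \<open>q x \<ge> - q (- x) \<ge> - p (- x)\<close>.
\<close>

lemma exists_minimal_sublinear:
  assumes p: "sublinear (p :: 'a::real_vector \<Rightarrow> real)"
  shows "\<exists>m. sublinear m \<and> m \<le> p \<and> (\<forall>q. sublinear q \<longrightarrow> q \<le> m \<longrightarrow> q = m)"
proof -
  define A where "A = {q. sublinear q \<and> q \<le> p}"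
  have "\<exists>m\<in>A. \<forall>a\<in>A. a \<le> m \<longrightarrow> a = m"
  proof (rule predicate_Zorn)
    show "partial_order_on A (relation_of (\<lambda>x y. y \<le> x) A)"
      by (rule partial_order_on_relation_ofI) auto
  next
    fix C assume C: "C \<in> Chains (relation_of (\<lambda>x y. y \<le> x) A)"
    then have CA: "C \<subseteq> A" and chain: "q \<in> C \<Longrightarrow> r \<in> C \<Longrightarrow> q \<le> r \<or> r \<le> q" for q r
      by (auto simp: Chains_def relation_of_def)
    show "\<exists>u\<in>A. \<forall>a\<in>C. u \<le> a"
    proof (cases "C = {}")
      case True then show ?thesis using p by (auto simp: A_def)
    next
      case False
      define u where "u x = (INF q\<in>C. q x)" for x
      have low: "u x \<le> q x" if "q \<in> C" for q x
        unfolding u_def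
      proof (rule cINF_lower)
        show "bdd_below ((\<lambda>q. q x) ` C)"
        proof (rule bdd_belowI2)
          fix q assume "q \<in> C"
          then have "sublinear q" "q (- x) \<le> p (- x)" using CA by (auto simp: A_def le_fun_def)
          then show "- p (- x) \<le> q x" using sublinear_lower[of q x] by simp
        qed
      qed (use that in auto)
      have great: "c \<le> u x" if "\<And>q. q \<in> C \<Longrightarrow> c \<le> q x" for c x
        unfolding u_def by (rule cINF_greatest) (use that False in auto)
      have "sublinear u"
        unfolding sublinear_def
      proof (intro conjI allI impI)
        fix x y
        have *: "u (x + y) \<le> q x + r y" if "q \<in> C" "r \<in> C" for q r
        proof -
          have "\<exists>s\<in>C. s \<le> q \<and> s \<le> r" using chain[OF that] that by auto
          then obtain s where s: "s \<in> C" "s \<le> q" "s \<le> r" by blast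
          have "u (x + y) \<le> s (x + y)" by (rule low[OF s(1)])
          also have "\<dots> \<le> s x + s y" using s(1) CA by (auto simp: A_def intro: sublinear_add)
          also have "\<dots> \<le> q x + r y" using s by (intro add_mono) (auto simp: le_fun_def)
          finally show ?thesis .
        qed
        have "u (x + y) - u x \<le> u y"
        proof (rule great)
          fix r assume r: "r \<in> C"
          have "u (x + y) - r y \<le> u x"
            by (rule great) (use *[OF _ r] in force)
          then show "u (x + y) - u x \<le> r y" by simp
        qed
        then show "u (x + y) \<le> u x + u y" by simp
      next
        fix t :: real and x assume t: "t > 0"
        have "u (t *\<^sub>R x) / t \<le> u x"
        proof (rule great)
          fix q assume q: "q \<in> C"
          have "u (t *\<^sub>R x) \<le> q (t *\<^sub>R x)" by (rule low[OF q])
          also have "\<dots> \<le> t * q x" using q CA t by (auto simp: A_def intro: sublinear_scale_le)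
          finally show "u (t *\<^sub>R x) / t \<le> q x" using t by (simp add: field_simps)
        qed
        then show "u (t *\<^sub>R x) \<le> t * u x" using t by (simp add: field_simps)
      qed
      moreover have "u \<le> p"
      proof -
        obtain q where "q \<in> C" using False by blast
        then have "u \<le> q" "q \<le> p" using low[of q] CA by (auto simp: A_def le_fun_def)
        then show ?thesis by (rule order_trans)
      qed
      ultimately show ?thesis using low by (auto simp: A_def le_fun_def)
    qed
  qed
  then obtain m where "m \<in> A" "\<forall>a\<in>A. a \<le> m \<longrightarrow> a = m" by blast
  then have "q = m" if "sublinear q" "q \<le> m" for q
    using that order_trans[OF that(2), of p] by (simp add: A_def)
  then show ?thesis using \<open>m \<in> A\<close> by (auto simp: A_def)
qed

text \<open>
  A minimal sublinear functional \<open>m\<close> is linear: anchoring \<open>m\<close> at \<open>y\<close> cannot make it smaller,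
  which is superadditivity. Starting Zorn's lemma below \<open>p\<close> anchored at \<open>x0\<close> forces
  the value at \<open>x0\<close>.
\<close>

lemma hahn_banach_sublinear:
  assumes p: "sublinear (p :: 'a::real_vector \<Rightarrow> real)"
  shows "\<exists>g. linear g \<and> g \<le> p \<and> g x0 = p x0"
proof -
  obtain m where m: "sublinear m" "m \<le> anchored p x0"
    and min: "\<And>q. sublinear q \<Longrightarrow> q \<le> m \<Longrightarrow> q = m"
    using exists_minimal_sublinear[OF sublinear_anchored[OF p, of x0]] by blast
  have "m x + m y \<le> m (x + y)" for x y
  proof -
    have "anchored m y = m"
      using min[OF sublinear_anchored[OF m(1), of y]] anchored_le[OF m(1), of 0]
      by (force simp: le_fun_def)
    then have "m x \<le> m (x + y) - m y" using anchored_le[OF m(1), of 1 y x] by simp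
    then show ?thesis by simp
  qed
  then have add: "m (x + y) = m x + m y" for x y
    using sublinear_add[OF m(1), of x y] by (intro antisym)
  then have neg: "m (- x) = - m x" for x
    using add[of x "- x"] sublinear_zero[OF m(1)] by simp
  have "linear m"
  proof (rule linearI[OF add])
    fix r :: real and x
    show "m (r *\<^sub>R x) = r *\<^sub>R m x"
    proof (cases "r \<ge> 0")
      case False
      then have "m ((- r) *\<^sub>R x) = - r * m x" using sublinear_scale[OF m(1), of "- r" x] by simp
      then show ?thesis using neg[of "r *\<^sub>R x"] by simp
    qed (use sublinear_scale[OF m(1)] in simp)
  qed
  moreover have mp: "m \<le> p"
  proof (rule le_funI)
    fix x
    have "m x \<le> anchored p x0 x" using m(2) by (simp add: le_fun_def)
    then show "m x \<le> p x" using anchored_le[OF p, of 0 x0 x] by simp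
  qed
  moreover have "m x0 = p x0"
  proof -
    have "m (- x0) \<le> p (- x0 + 1 *\<^sub>R x0) - 1 * p x0"
      using le_funD[OF m(2), of "- x0"] anchored_le[OF p, of 1 x0 "- x0"] by linarith
    then have "p x0 \<le> m x0" using neg[of x0] sublinear_zero[OF p] by simp
    then show ?thesis using mp by (simp add: le_fun_def antisym)
  qed
  ultimately show ?thesis by blast
qed

lemma sublinear_infdist:
  fixes Y :: "'a::real_normed_vector set"
  assumes Y: "subspace Y"
  shows "sublinear (\<lambda>x. infdist x Y)"
proof -
  have ne: "Y \<noteq> {}" using subspace_0[OF Y] by blast
  have great: "c \<le> infdist x Y" if "\<And>a. a \<in> Y \<Longrightarrow> c \<le> dist x a" for c x
    unfolding infdist_notempty[OF ne] by (rule cINF_greatest[OF ne that])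
  show ?thesis
    unfolding sublinear_def
  proof (intro conjI allI impI)
    fix x y :: 'a
    have *: "infdist (x + y) Y \<le> dist x a + dist y b" if "a \<in> Y" "b \<in> Y" for a b
    proof -
      have "infdist (x + y) Y \<le> dist (x + y) (a + b)"
        by (rule infdist_le) (use subspace_add[OF Y] that in blast)
      also have "\<dots> \<le> dist x a + dist y b" by (rule dist_triangle_add)
      finally show ?thesis .
    qed
    have "infdist (x + y) Y - infdist x Y \<le> infdist y Y"
    proof (rule great)
      fix b assume b: "b \<in> Y"
      have "infdist (x + y) Y - dist y b \<le> infdist x Y" by (rule great) (use *[OF _ b] in force)
      then show "infdist (x + y) Y - infdist x Y \<le> dist y b" by simp
    qed
    then show "infdist (x + y) Y \<le> infdist x Y + infdist y Y" by simp
  next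
    fix t :: real and x :: 'a assume t: "t > 0"
    have "infdist (t *\<^sub>R x) Y / t \<le> infdist x Y"
    proof (rule great)
      fix a assume "a \<in> Y"
      then have "infdist (t *\<^sub>R x) Y \<le> dist (t *\<^sub>R x) (t *\<^sub>R a)"
        by (intro infdist_le subspace_scale[OF Y])
      moreover have "dist (t *\<^sub>R x) (t *\<^sub>R a) = t * dist x a"
        using t by (simp add: dist_norm flip: scaleR_diff_right)
      ultimately show "infdist (t *\<^sub>R x) Y / t \<le> dist x a" using t by (simp add: field_simps)
    qed
    then show "infdist (t *\<^sub>R x) Y \<le> t * infdist x Y" using t by (simp add: field_simps)
  qed
qed

text \<open>
  A linear functional below the distance to \<open>Y\<close> vanishes on \<open>Y\<close> and is bounded by the norm.
\<close>

lemma hahn_banach_real: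
  fixes Y :: "'a::real_normed_vector set"
  assumes Y: "subspace Y" "closed Y" and x: "x \<notin> Y"
  shows "\<exists>g::'a \<Rightarrow> real. bounded_linear g \<and> (\<forall>y\<in>Y. g y = 0) \<and> g x \<noteq> 0"
proof -
  have 0: "0 \<in> Y" by (rule subspace_0[OF Y(1)])
  obtain g where g: "linear g" "g \<le> (\<lambda>x. infdist x Y)" "g x = infdist x Y"
    using hahn_banach_sublinear[OF sublinear_infdist[OF Y(1)], of x] by blast
  have le: "\<bar>g z\<bar> \<le> infdist z Y" for z
  proof -
    have "- g z = g (- z)" using linear_neg[OF g(1), of z] by simp
    also have "\<dots> \<le> infdist (- z) Y" using g(2) by (simp add: le_fun_def)
    also have "\<dots> \<le> infdist z Y"
      unfolding infdist_notempty[OF ex_in_conv[THEN iffD1, OF exI[of "\<lambda>y. y \<in> Y", OF 0]], of z]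
    proof (rule cINF_greatest)
      fix a assume "a \<in> Y"
      then have "infdist (- z) Y \<le> dist (- z) (- a)"
        by (intro infdist_le subspace_neg[OF Y(1)])
      then show "infdist (- z) Y \<le> dist z a" by (simp add: dist_minus)
    qed (use 0 in blast)
    finally show ?thesis using g(2) by (simp add: le_fun_def abs_le_iff)
  qed
  have "bounded_linear g"
  proof (rule bounded_linear_intro[of g 1])
    show "norm (g z) \<le> norm z * 1" for z
      using le[of z] infdist_le[OF 0, of z] by simp
  qed (simp_all add: linear_add[OF g(1)] linear_scale[OF g(1)])
  moreover have "g y = 0" if "y \<in> Y" for y using le[of y] that by simp
  moreover have "g x \<noteq> 0"
  proof -
    have "Y \<noteq> {}" using 0 by blast
    then show ?thesis using g(3) infdist_pos_not_in_closed[OF Y(2) _ x] by simp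
  qed
  ultimately show ?thesis by blast
qed

section \<open>Bounded operators and functionals over the scalar field\<close>

context banach_space_over
begin

lemma bounded_linear_over_iff:
  "bounded_linear_over smul smul T \<longleftrightarrow> bounded_linear T \<and> (\<forall>c x. T (smul c x) = smul c (T x))"
proof
  assume T: "bounded_linear_over smul smul T"
  then interpret T: Vector_Spaces.linear smul smul T by (simp add: bounded_linear_over_def)
  obtain K where K: "\<And>x. norm (T x) \<le> norm x * K" using T by (auto simp: bounded_linear_over_def)
  have "bounded_linear T"
  proof (rule bounded_linear_intro[OF T.add _ K])
    show "T (r *\<^sub>R x) = r *\<^sub>R T x" for r x
      using T.scale[of "of_real r" x] by (simp add: smul_of_real)
  qed
  then show "bounded_linear T \<and> (\<forall>c x. T (smul c x) = smul c (T x))" using T.scale by blast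
next
  assume T: "bounded_linear T \<and> (\<forall>c x. T (smul c x) = smul c (T x))"
  then interpret T: bounded_linear T by blast
  have "Vector_Spaces.linear smul smul T"
    by unfold_locales (use T T.add in auto)
  then show "bounded_linear_over smul smul T" using T.bounded by (auto simp: bounded_linear_over_def)
qed

lemma dual_space_iff:
  "f \<in> dual_space smul \<longleftrightarrow> bounded_linear f \<and> (\<forall>c x. f (smul c x) = c * f x)"
proof
  assume "f \<in> dual_space smul"
  then have T: "bounded_linear_over smul (*) f" by (simp add: dual_space_def)
  then interpret T: Vector_Spaces.linear smul "(*)" f by (simp add: bounded_linear_over_def)
  obtain K where K: "\<And>x. norm (f x) \<le> norm x * K" using T by (auto simp: bounded_linear_over_def)
  have "bounded_linear f"
  proof (rule bounded_linear_intro[OF T.add _ K])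
    show "f (r *\<^sub>R x) = r *\<^sub>R f x" for r x
      using T.scale[of "of_real r" x] by (simp add: smul_of_real scaleR_conv_of_real)
  qed
  then show "bounded_linear f \<and> (\<forall>c x. f (smul c x) = c * f x)" using T.scale by blast
next
  assume T: "bounded_linear f \<and> (\<forall>c x. f (smul c x) = c * f x)"
  then interpret T: bounded_linear f by blast
  have "Vector_Spaces.linear smul (*) f"
    by unfold_locales (use T T.add in \<open>auto simp: algebra_simps\<close>)
  then show "f \<in> dual_space smul" using T.bounded by (auto simp: bounded_linear_over_def dual_space_def)
qed

end

text \<open>
  With the Hahn-Banach theorem as an assumption and locally compact scalars, the real and the
  complex case are treated at once.
\<close>

locale separated_banach_space = banach_space_over smul
  for smul :: "'k::{real_normed_field,heine_borel} \<Rightarrow> 'a::banach \<Rightarrow> 'a" +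
  assumes hahn_banach: "module.subspace smul Y \<Longrightarrow> closed Y \<Longrightarrow> x \<notin> Y \<Longrightarrow>
    \<exists>g\<in>dual_space smul. (\<forall>y\<in>Y. g y = 0) \<and> g x \<noteq> 0"

lemma separated_banach_space_real:
  "separated_banach_space (scaleR :: real \<Rightarrow> 'a::banach \<Rightarrow> 'a)"
proof -
  interpret banach_space_over "scaleR :: real \<Rightarrow> 'a \<Rightarrow> 'a" by (rule banach_space_over_scaleR)
  show ?thesis
  proof
    fix Y and x :: 'a assume Y: "module.subspace (*\<^sub>R) Y" "closed Y" "x \<notin> Y"
    have "Real_Vector_Spaces.subspace Y"
      using Y(1) by (simp add: module.subspace_def[OF module_axioms] Real_Vector_Spaces.subspace_def)
    then obtain g :: "'a \<Rightarrow> real" where g: "bounded_linear g" "\<forall>y\<in>Y. g y = 0" "g x \<noteq> 0"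
      using hahn_banach_real Y by blast
    then have "g \<in> dual_space (*\<^sub>R)"
      by (auto simp: dual_space_iff linear_scale[OF bounded_linear.linear[OF g(1)]])
    then show "\<exists>g\<in>dual_space (*\<^sub>R). (\<forall>y\<in>Y. g y = 0) \<and> g x \<noteq> 0" using g by blast
  qed
qed

text \<open>
  The real part of a complex functional \<open>G\<close> is a real functional \<open>g\<close> with
  \<open>G z = g z - \<i> * g (\<i> z)\<close>, so \<open>G\<close> is recovered from a real separating functional.
\<close>

lemma separated_banach_space_complex:
  assumes "banach_space_over (smul :: complex \<Rightarrow> 'a::banach \<Rightarrow> 'a)"
  shows "separated_banach_space smul"
proof -
  interpret banach_space_over smul by (rule assms)
  show ?thesis
  proof
    fix Y and x :: 'a assume Y: "module.subspace smul Y" "closed Y" "x \<notin> Y"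
    have "Real_Vector_Spaces.subspace Y"
      using Y(1) unfolding subspace_def Real_Vector_Spaces.subspace_def
      by (metis smul_of_real)
    then obtain g :: "'a \<Rightarrow> real" where g: "bounded_linear g" "\<forall>y\<in>Y. g y = 0" "g x \<noteq> 0"
      using hahn_banach_real Y by blast
    interpret g: bounded_linear g by (rule g(1))
    have i: "bounded_linear (smul \<i>)"
    proof (rule bounded_linear_intro[where K = 1])
      show "smul \<i> (r *\<^sub>R x) = r *\<^sub>R smul \<i> x" for r x
        by (simp add: smul_of_real[symmetric] scale_left_commute)
    qed (simp_all add: scale_right_distrib norm_smul)
    define G where "G z = of_real (g z) - \<i> * of_real (g (smul \<i> z))" for z
    have "bounded_linear G"
      unfolding G_def
      by (intro bounded_linear_sub bounded_linear_const_mult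
          bounded_linear_compose[OF bounded_linear_of_real] g(1)
          bounded_linear_compose[OF g(1) i])
    moreover have "G (smul c z) = c * G z" for c z
    proof -
      have c: "smul c z = Re c *\<^sub>R z + Im c *\<^sub>R smul \<i> z"
      proof -
        have "smul c z = smul (of_real (Re c) + of_real (Im c) * \<i>) z"
          by (subst complex_eq[of c]) (simp add: mult.commute)
        then show ?thesis by (simp only: scale_left_distrib smul_of_real flip: scale_scale)
      qed
      have ii: "smul \<i> (smul \<i> z) = - z" for z by simp
      have ic: "smul \<i> (smul c z) = Re c *\<^sub>R smul \<i> z + Im c *\<^sub>R (- z)"
        by (simp only: c scale_right_distrib linear_scale[OF bounded_linear.linear[OF i]] ii)
      show ?thesis
        unfolding G_def ic
        by (simp add: c g.add g.scaleR g.neg g.diff complex_eq_iff algebra_simps)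
    qed
    ultimately have "G \<in> dual_space smul" by (simp add: dual_space_iff)
    moreover have "G y = 0" if "y \<in> Y" for y
      using g(2) that subspace_scale[OF Y(1), of y \<i>] by (simp add: G_def)
    moreover have "G x \<noteq> 0" using g(3) by (auto simp: G_def complex_eq_iff)
    ultimately show "\<exists>g\<in>dual_space smul. (\<forall>y\<in>Y. g y = 0) \<and> g x \<noteq> 0" by blast
  qed
qed

text \<open>
  Split \<open>B\<close> into the finitely many preimages of small balls under one of the functions, and treat the
  other functions on each piece. The lemma replaces compactness both in the unit ball of the space, with the
  coefficient functionals as \<open>\<phi>\<close>, and in the dual ball, with evaluations at the basis vectors.
\<close>

lemma finite_net:
  fixes \<phi> :: "'i \<Rightarrow> 'b \<Rightarrow> 'k::heine_borel"
  assumes I: "finite I" and bd: "\<And>i. i \<in> I \<Longrightarrow> bounded (\<phi> i ` B)" and \<tau>: "\<tau> > 0"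
  shows "\<exists>N. finite N \<and> N \<subseteq> B \<and> (\<forall>b\<in>B. \<exists>b'\<in>N. \<forall>i\<in>I. dist (\<phi> i b) (\<phi> i b') < \<tau>)"
  using I bd
proof (induction I arbitrary: B)
  case empty
  show ?case
  proof (cases "B = {}")
    case False
    then obtain b where "b \<in> B" by blast
    then show ?thesis by (intro exI[of _ "{b}"]) auto
  qed auto
next
  case (insert i I)
  have "compact (closure (\<phi> i ` B))" using insert.prems by (simp add: compact_closure)
  then obtain C where C: "finite C" "closure (\<phi> i ` B) \<subseteq> (\<Union>c\<in>C. ball c (\<tau>/2))"
    using \<tau> compactE_image[of "closure (\<phi> i ` B)" "closure (\<phi> i ` B)" "\<lambda>c. ball c (\<tau>/2)"]
    by (metis (no_types, lifting) UN_I centre_in_ball half_gt_zero open_ball subsetI)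
  define D where "D c = {b\<in>B. \<phi> i b \<in> ball c (\<tau>/2)}" for c
  have "\<exists>N. finite N \<and> N \<subseteq> D c \<and> (\<forall>b\<in>D c. \<exists>b'\<in>N. \<forall>i\<in>I. dist (\<phi> i b) (\<phi> i b') < \<tau>)" for c
  proof (rule insert.IH)
    fix j assume "j \<in> I"
    then show "bounded (\<phi> j ` D c)"
      by (intro bounded_subset[OF insert.prems[of j]]) (auto simp: D_def)
  qed
  then obtain N where N: "\<And>c. finite (N c)" "\<And>c. N c \<subseteq> D c"
    "\<And>c. \<forall>b\<in>D c. \<exists>b'\<in>N c. \<forall>i\<in>I. dist (\<phi> i b) (\<phi> i b') < \<tau>"
    by metis
  show ?case
  proof (intro exI[of _ "\<Union>c\<in>C. N c"] conjI ballI)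
    show "finite (\<Union>c\<in>C. N c)" using C N by blast
    show "(\<Union>c\<in>C. N c) \<subseteq> B" using N(2) by (auto simp: D_def)
    fix b assume b: "b \<in> B"
    then obtain c where c: "c \<in> C" "\<phi> i b \<in> ball c (\<tau>/2)"
      using C(2) closure_subset by blast
    then have "b \<in> D c" using b by (simp add: D_def)
    then obtain b' where b': "b' \<in> N c" "\<forall>i\<in>I. dist (\<phi> i b) (\<phi> i b') < \<tau>" using N(3) by blast
    then have "\<phi> i b' \<in> ball c (\<tau>/2)" using N(2) by (auto simp: D_def)
    then have "dist (\<phi> i b) (\<phi> i b') < \<tau>"
      using c(2) dist_triangle_half_r[of c "\<phi> i b" \<tau> "\<phi> i b'"] by simp
    then show "\<exists>b'\<in>\<Union>c\<in>C. N c. \<forall>i\<in>insert i I. dist (\<phi> i b) (\<phi> i b') < \<tau>"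
      using b' c(1) by blast
  qed
qed

context banach_space_over
begin

abbreviation "dual \<equiv> dual_space smul"

lemma dual_bounded_linear: "f \<in> dual \<Longrightarrow> bounded_linear f"
  and dual_scale: "f \<in> dual \<Longrightarrow> f (smul c x) = c * f x"
  by (auto simp: dual_space_iff)

lemma dual_add: "f \<in> dual \<Longrightarrow> f (x + y) = f x + f y"
  and dual_diff: "f \<in> dual \<Longrightarrow> f (x - y) = f x - f y"
  and dual_zero: "f \<in> dual \<Longrightarrow> f 0 = 0"
  and dual_sum: "f \<in> dual \<Longrightarrow> f (\<Sum>i\<in>I. v i) = (\<Sum>i\<in>I. f (v i))"
  by (auto simp: dual_bounded_linear linear_add linear_diff linear_0 linear_sum bounded_linear.linear)

lemma bounded_linear_smul: "bounded_linear (smul c)"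
proof (rule bounded_linear_intro[where K = "norm c"])
  show "smul c (r *\<^sub>R x) = r *\<^sub>R smul c x" for r x
    by (simp add: smul_of_real[symmetric] scale_left_commute)
qed (simp_all add: scale_right_distrib norm_smul mult.commute)

lemma bounded_linear_smul_left: "bounded_linear (\<lambda>c. smul c v)"
proof (rule bounded_linear_intro[where K = "norm v"])
  show "smul (r *\<^sub>R c) v = r *\<^sub>R smul c v" for r c
    by (simp add: smul_of_real[symmetric] scaleR_conv_of_real)
qed (simp_all add: scale_left_distrib norm_smul)

lemma dual_minus: "f \<in> dual \<Longrightarrow> g \<in> dual \<Longrightarrow> (\<lambda>x. f x - g x) \<in> dual"
  by (auto simp: dual_space_iff intro: bounded_linear_sub simp: algebra_simps)

lemma dual_cmult: "f \<in> dual \<Longrightarrow> (\<lambda>x. c * f x) \<in> dual"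
  by (auto simp: dual_space_iff intro: bounded_linear_const_mult)

lemma dual_sum_functionals: "(\<And>i. i \<in> I \<Longrightarrow> f i \<in> dual) \<Longrightarrow> (\<lambda>x. \<Sum>i\<in>I. f i x) \<in> dual"
  by (auto simp: dual_space_iff intro: bounded_linear_sum simp: sum_distrib_left)

abbreviation operator :: "('a \<Rightarrow> 'a) \<Rightarrow> bool" where
  "operator \<equiv> bounded_linear_over smul smul"

lemma operator_bounded_linear: "operator T \<Longrightarrow> bounded_linear T"
  and operator_scale: "operator T \<Longrightarrow> T (smul c x) = smul c (T x)"
  by (auto simp: bounded_linear_over_iff)

lemma operator_add: "operator T \<Longrightarrow> T (x + y) = T x + T y"
  and operator_diff: "operator T \<Longrightarrow> T (x - y) = T x - T y"
  and operator_zero: "operator T \<Longrightarrow> T 0 = 0"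
  and operator_sum: "operator T \<Longrightarrow> T (\<Sum>i\<in>I. v i) = (\<Sum>i\<in>I. T (v i))"
  by (auto simp: operator_bounded_linear linear_add linear_diff linear_0 linear_sum bounded_linear.linear)

lemma operator_minus: "operator S \<Longrightarrow> operator T \<Longrightarrow> operator (\<lambda>x. S x - T x)"
  by (auto simp: bounded_linear_over_iff intro: bounded_linear_sub simp: scale_right_diff_distrib)

lemma operator_compose: "operator S \<Longrightarrow> operator T \<Longrightarrow> operator (\<lambda>x. S (T x))"
  by (auto simp: bounded_linear_over_iff intro: bounded_linear_compose)

lemma dual_compose: "f \<in> dual \<Longrightarrow> operator T \<Longrightarrow> (\<lambda>x. f (T x)) \<in> dual"
  by (auto simp: bounded_linear_over_iff dual_space_iff intro: bounded_linear_compose)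

lemma operator_rank_one: "f \<in> dual \<Longrightarrow> operator (\<lambda>x. smul (f x) v)"
  by (auto simp: bounded_linear_over_iff dual_space_iff
      intro: bounded_linear_compose[OF bounded_linear_smul_left])

lemma operator_sum_operators: "(\<And>i. i \<in> I \<Longrightarrow> operator (T i)) \<Longrightarrow> operator (\<lambda>x. \<Sum>i\<in>I. T i x)"
  by (auto simp: bounded_linear_over_iff intro: bounded_linear_sum simp: scale_sum_right)

end

section \<open>Finite biorthogonal systems\<close>

context banach_space_over
begin

text \<open>
  Systems are sets of pairs of a vector and its coefficient functional, so that extensions
  and unions of systems are inclusions and unions of sets. The operator \<open>Q\<close> is a projection whose
  range is the subspace to be equipped with a basis: the vectors lie in the range, and the functionals
  live on the whole space but factor through \<open>Q\<close>.
\<close>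

definition biorthogonal :: "('a \<Rightarrow> 'a) \<Rightarrow> ('a \<times> ('a \<Rightarrow> 'k)) set \<Rightarrow> bool" where
  "biorthogonal Q B \<longleftrightarrow>
     (\<forall>p\<in>B. snd p \<in> dual \<and> Q (fst p) = fst p \<and> (\<forall>x. snd p (Q x) = snd p x)) \<and>
     (\<forall>p\<in>B. \<forall>q\<in>B. snd p (fst q) = (if p = q then 1 else 0))"

definition expansion :: "('a \<times> ('a \<Rightarrow> 'k)) set \<Rightarrow> 'a \<Rightarrow> 'a" where
  "expansion B x = (\<Sum>p\<in>B. smul (snd p x) (fst p))"

lemma biorthogonal_subset: "biorthogonal Q B \<Longrightarrow> C \<subseteq> B \<Longrightarrow> biorthogonal Q C"
  unfolding biorthogonal_def by blast

lemma biorthogonal_dual: "biorthogonal Q B \<Longrightarrow> p \<in> B \<Longrightarrow> snd p \<in> dual"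
  and biorthogonal_range: "biorthogonal Q B \<Longrightarrow> p \<in> B \<Longrightarrow> Q (fst p) = fst p"
  and biorthogonal_absorb: "biorthogonal Q B \<Longrightarrow> p \<in> B \<Longrightarrow> snd p (Q x) = snd p x"
  and biorthogonal_eq: "biorthogonal Q B \<Longrightarrow> p \<in> B \<Longrightarrow> q \<in> B \<Longrightarrow> snd p (fst q) = (if p = q then 1 else 0)"
  unfolding biorthogonal_def by blast+

lemma biorthogonal_Un:
  assumes "biorthogonal Q B" "biorthogonal Q C"
    and "\<And>p q. p \<in> B \<Longrightarrow> q \<in> C \<Longrightarrow> snd p (fst q) = 0 \<and> snd q (fst p) = 0"
  shows "biorthogonal Q (B \<union> C)"
proof -
  have "p \<noteq> q" if "p \<in> B" "q \<in> C" for p q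
    using assms(3)[OF that] biorthogonal_eq[OF assms(1) that(1) that(1)] by auto
  then show ?thesis
    using assms unfolding biorthogonal_def by (auto simp: ball_Un)
qed

lemma operator_expansion:
  assumes "biorthogonal Q B" shows "operator (expansion B)"
  unfolding expansion_def using assms
  by (intro operator_sum_operators operator_rank_one) (auto simp: biorthogonal_dual)

lemma functional_expansion:
  assumes "g \<in> dual" shows "g (expansion B x) = (\<Sum>p\<in>B. snd p x * g (fst p))"
  unfolding expansion_def using assms by (simp add: dual_sum dual_scale)

lemma coefficient_expansion:
  assumes "biorthogonal Q C" "finite C" "B \<subseteq> C" "p \<in> C"
  shows "snd p (expansion B x) = (if p \<in> B then snd p x else 0)"
proof -
  have "finite B" using assms finite_subset by blast
  have "snd p (expansion B x) = (\<Sum>q\<in>B. snd q x * snd p (fst q))"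
    using assms by (simp add: functional_expansion biorthogonal_dual)
  also have "\<dots> = (\<Sum>q\<in>B. if p = q then snd q x else 0)"
  proof (rule sum.cong[OF refl])
    fix q assume "q \<in> B"
    then have "q \<in> C" using assms(3) by blast
    then show "snd q x * snd p (fst q) = (if p = q then snd q x else 0)"
      using biorthogonal_eq[OF assms(1,4)] by simp
  qed
  also have "\<dots> = (if p \<in> B then snd p x else 0)" using \<open>finite B\<close> by simp
  finally show ?thesis .
qed

lemma expansion_expansion:
  assumes "biorthogonal Q C" "finite C" "B \<subseteq> C"
  shows "expansion C (expansion B x) = expansion B x"
    and "expansion B (expansion C x) = expansion B x"
proof -
  have "expansion C (expansion B x) = (\<Sum>p\<in>C. if p \<in> B then smul (snd p x) (fst p) else 0)"
    unfolding expansion_def[of C] using assms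
    by (intro sum.cong refl) (simp add: coefficient_expansion[OF assms])
  also have "\<dots> = expansion B x"
    unfolding expansion_def using assms by (simp add: sum.If_cases Int_absorb1)
  finally show "expansion C (expansion B x) = expansion B x" .
  show "expansion B (expansion C x) = expansion B x"
    unfolding expansion_def[of B]
  proof (rule sum.cong[OF refl])
    fix q assume "q \<in> B"
    then have "q \<in> C" using assms(3) by blast
    then show "smul (snd q (expansion C x)) (fst q) = smul (snd q x) (fst q)"
      using coefficient_expansion[OF assms(1,2) order_refl, of q x] by simp
  qed
qed

lemma expansion_absorb:
  assumes "biorthogonal Q B"
  shows "expansion B (Q x) = expansion B x"
  unfolding expansion_def by (intro sum.cong refl) (simp add: biorthogonal_absorb[OF assms])

lemma expansion_range:
  assumes "biorthogonal Q B" "operator Q"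
  shows "Q (expansion B x) = expansion B x"
  unfolding expansion_def
  by (simp add: operator_sum[OF assms(2)] operator_scale[OF assms(2)]
      biorthogonal_range[OF assms(1)] cong: sum.cong)

lemma expansion_fst:
  assumes "biorthogonal Q B" "finite B" "p \<in> B"
  shows "expansion B (fst p) = fst p"
proof -
  have "expansion B (fst p) = (\<Sum>q\<in>B. if q = p then fst p else 0)"
    unfolding expansion_def
    by (intro sum.cong refl) (use assms in \<open>auto simp: biorthogonal_eq\<close>)
  then show ?thesis using assms by simp
qed

lemma expansion_Un_disjoint:
  assumes "finite B" "finite C" "B \<inter> C = {}"
  shows "expansion (B \<union> C) x = expansion B x + expansion C x"
  unfolding expansion_def using assms by (rule sum.union_disjoint)

lemma expansion_fixed_mono:
  assumes "biorthogonal Q C" "finite C" "B \<subseteq> C" "expansion B d = d"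
  shows "expansion C d = d"
  using expansion_expansion(1)[OF assms(1-3), of d] assms(4) by simp

end

context banach_space_over
begin

lemma subspace_closure:
  assumes "subspace Y" shows "subspace (closure Y)"
proof -
  have add: "x + y \<in> closure Y" if xy: "x \<in> closure Y" "y \<in> closure Y" for x y
  proof -
    obtain u v where "\<And>n. u n \<in> Y" "u \<longlonglongrightarrow> x" "\<And>n. v n \<in> Y" "v \<longlonglongrightarrow> y"
      using xy unfolding closure_sequential by metis
    then show ?thesis
      unfolding closure_sequential using subspace_add[OF assms]
      by (intro exI[of _ "\<lambda>n. u n + v n"]) (auto intro: tendsto_add)
  qed
  have "smul c x \<in> closure Y" if "x \<in> closure Y" for c x
  proof -
    have "smul c ` closure Y \<subseteq> closure Y"
      by (rule image_closure_subset)
        (use subspace_scale[OF assms] closure_subset in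
          \<open>auto intro: linear_continuous_on[OF bounded_linear_smul]\<close>)
    then show ?thesis using that by blast
  qed
  then show ?thesis
    using subspace_0[OF assms] closure_subset[of Y] add by (auto simp: subspace_def)
qed

definition contractive :: "('a \<Rightarrow> 'k) \<Rightarrow> bool" where
  "contractive g \<longleftrightarrow> g \<in> dual \<and> (\<forall>v. norm (g v) \<le> norm v)"

lemma dual_bound: "f \<in> dual \<Longrightarrow> \<exists>K>0. \<forall>x. norm (f x) \<le> norm x * K"
  using bounded_linear.pos_bounded dual_bounded_linear by blast

lemma coefficient_bounds:
  assumes "biorthogonal Q C" "finite C"
  shows "\<exists>m>0. \<forall>z. (\<Sum>p\<in>C. norm (snd p z)) \<le> m * norm z"
proof -
  have "\<forall>p\<in>C. \<exists>K>0. \<forall>x. norm (snd p x) \<le> norm x * K"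
    using dual_bound biorthogonal_dual[OF assms(1)] by blast
  then obtain K where K: "\<And>p. p \<in> C \<Longrightarrow> K p > 0" "\<And>p x. p \<in> C \<Longrightarrow> norm (snd p x) \<le> norm x * K p"
    by metis
  show ?thesis
  proof (intro exI[of _ "1 + sum K C"] conjI allI)
    have s: "0 \<le> sum K C" using K(1) by (simp add: sum_nonneg less_imp_le)
    then show "0 < 1 + sum K C" by simp
    fix z
    have "(\<Sum>p\<in>C. norm (snd p z)) \<le> (\<Sum>p\<in>C. norm z * K p)" using K(2) by (intro sum_mono)
    also have "\<dots> = norm z * sum K C" by (simp add: sum_distrib_left)
    also have "\<dots> \<le> (1 + sum K C) * norm z" by (simp add: algebra_simps)
    finally show "(\<Sum>p\<in>C. norm (snd p z)) \<le> (1 + sum K C) * norm z" .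
  qed
qed

text \<open>
  The functional \<open>\<phi>\<close> is the restriction of \<open>h\<close> to the range of \<open>Q\<close>, made to vanish on the vectors of \<open>C\<close>.
\<close>

lemma biorthogonal_adjoin:
  assumes Q: "operator Q" "\<And>x. Q (Q x) = Q x" and C: "biorthogonal Q C" "finite C"
    and h: "h \<in> dual" and \<phi>: "\<phi> = (\<lambda>x. h (Q x - expansion C x))"
    and u: "Q u = u" "expansion C u = 0" "h u = 1"
  shows "(u, \<phi>) \<notin> C" "biorthogonal Q (insert (u, \<phi>) C)"
proof -
  have \<phi>u: "\<phi> u = 1" using u by (simp add: \<phi>)
  have 1: "snd p u = 0" if "p \<in> C" for p
    using coefficient_expansion[OF C order_refl that, of u] that u(2) biorthogonal_dual[OF C(1) that]
    by (simp add: dual_zero)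
  have 2: "\<phi> (fst p) = 0" if "p \<in> C" for p
    using biorthogonal_range[OF C(1) that] expansion_fst[OF C that] h by (simp add: \<phi> dual_zero)
  have 3: "\<phi> \<in> dual"
    unfolding \<phi> by (intro dual_compose[OF h] operator_minus Q(1) operator_expansion[OF C(1)])
  have 4: "\<phi> (Q x) = \<phi> x" for x
    unfolding \<phi> by (simp add: Q(2) expansion_absorb[OF C(1)])
  show "(u, \<phi>) \<notin> C" using 1[of "(u, \<phi>)"] \<phi>u by auto
  have "biorthogonal Q {(u, \<phi>)}" unfolding biorthogonal_def using 3 4 u \<phi>u by simp
  then have "biorthogonal Q ({(u, \<phi>)} \<union> C)"
    by (rule biorthogonal_Un[OF _ C(1)]) (use 1 2 in auto)
  then show "biorthogonal Q (insert (u, \<phi>) C)" by simp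
qed

text \<open>
  For each \<open>h\<close>, if its part \<open>h \<circ> (Q - expansion C)\<close> is not yet a combination of the new
  functionals, its remainder is adjoined, with some dual vector. In the end \<open>h z - h (expansion C z)\<close> depends only on the new
  coefficients of \<open>z\<close>. The new vectors may have large norms; this is compensated by the number \<open>a\<close>
  in \<open>perturbed_extension\<close>.
\<close>

lemma extend_functionals:
  assumes Q: "operator Q" "\<And>x. Q (Q x) = Q x" and C: "biorthogonal Q C" "finite C"
    and H: "finite H" "H \<subseteq> dual"
  shows "\<exists>A. finite A \<and> A \<inter> C = {} \<and> biorthogonal Q (C \<union> A) \<and>
    (\<forall>h\<in>H. \<forall>z. Q z = z \<longrightarrow> (\<forall>p\<in>A. snd p z = 0) \<longrightarrow> h z = h (expansion C z))"
  using H
proof (induction H)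
  case empty
  show ?case by (intro exI[of _ "{}"]) (use C in simp)
next
  case (insert h H)
  then obtain A where A: "finite A" "A \<inter> C = {}" "biorthogonal Q (C \<union> A)"
    "\<And>k z. k \<in> H \<Longrightarrow> Q z = z \<Longrightarrow> (\<forall>p\<in>A. snd p z = 0) \<Longrightarrow> k z = k (expansion C z)"
    by auto
  define C' where "C' = C \<union> A"
  have C': "biorthogonal Q C'" "finite C'" using A C by (auto simp: C'_def)
  have h: "h \<in> dual" using insert.prems by simp
  have exp: "expansion C' z = expansion C z" if "\<And>p. p \<in> A \<Longrightarrow> snd p z = 0" for z
  proof -
    have "expansion A z = 0" unfolding expansion_def using that by simp
    then show ?thesis using expansion_Un_disjoint[OF C(2) A(1), of z] A(2) by (auto simp: C'_def)
  qed
  define \<phi> where "\<phi> = (\<lambda>x. h (Q x - expansion C' x))"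
  have hz: "h z = \<phi> z + h (expansion C z)" if "Q z = z" "\<And>p. p \<in> A \<Longrightarrow> snd p z = 0" for z
    using that exp by (simp add: \<phi>_def dual_diff[OF h])
  show ?case
  proof (cases "\<forall>v. \<phi> v = 0")
    case True
    then show ?thesis using A hz by (intro exI[of _ A]) auto
  next
    case False
    then obtain v where v: "\<phi> v \<noteq> 0" by blast
    define u where "u = smul (1 / \<phi> v) (Q v - expansion C' v)"
    have u: "Q u = u" "expansion C' u = 0" "h u = 1"
    proof -
      show "Q u = u"
        by (simp add: u_def operator_scale[OF Q(1)] operator_diff[OF Q(1)] Q(2)
            expansion_range[OF C'(1) Q(1)])
      show "expansion C' u = 0"
        by (simp add: u_def operator_scale[OF operator_expansion[OF C'(1)]]
            operator_diff[OF operator_expansion[OF C'(1)]] expansion_absorb[OF C'(1)]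
            expansion_expansion[OF C' order_refl])
      show "h u = 1" using v by (simp add: u_def dual_scale[OF h] \<phi>_def)
    qed
    note ad = biorthogonal_adjoin[OF Q C' h \<phi>_def u]
    show ?thesis
    proof (intro exI[of _ "insert (u, \<phi>) A"] conjI ballI allI impI)
      show "finite (insert (u, \<phi>) A)" using A by simp
      show "insert (u, \<phi>) A \<inter> C = {}" using A ad(1) by (auto simp: C'_def)
      show "biorthogonal Q (C \<union> insert (u, \<phi>) A)" using ad(2) by (simp add: C'_def)
      fix k z assume k: "k \<in> insert h H" and z: "Q z = z" "\<forall>p\<in>insert (u, \<phi>) A. snd p z = 0"
      then show "k z = k (expansion C z)"
        using hz[of z] A(4)[of k z] by auto
    qed
  qed
qed

lemma expansion_transfer:
  assumes D: "biorthogonal Q D" and "\<And>p. p \<in> C \<Longrightarrow> expansion D (fst p) = fst p"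
  shows "expansion D (expansion C x) = expansion C x"
  unfolding expansion_def[of C]
  using assms(2)
  by (simp add: operator_sum[OF operator_expansion[OF D]] operator_scale[OF operator_expansion[OF D]]
      cong: sum.cong)

end

context separated_banach_space
begin

lemma finite_functional_net:
  assumes C: "biorthogonal Q C" "finite C"
  shows "\<exists>H. finite H \<and> (\<forall>h\<in>H. contractive h) \<and>
    (\<forall>g. contractive g \<longrightarrow> (\<exists>h\<in>H. \<forall>z. norm (g (expansion C z) - h (expansion C z)) \<le> norm z))"
proof -
  obtain m where m: "m > 0" "\<And>z. (\<Sum>p\<in>C. norm (snd p z)) \<le> m * norm z"
    using coefficient_bounds[OF C] by blast
  have "\<exists>H. finite H \<and> H \<subseteq> {g. contractive g} \<and>
      (\<forall>g\<in>{g. contractive g}. \<exists>h\<in>H. \<forall>p\<in>C. dist (g (fst p)) (h (fst p)) < 1 / m)"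
  proof (rule finite_net)
    fix p assume "p \<in> C"
    show "bounded ((\<lambda>g. g (fst p)) ` {g. contractive g})"
      unfolding bounded_iff by (intro exI[of _ "norm (fst p)"]) (auto simp: contractive_def)
  qed (use C m in auto)
  then obtain H where H: "finite H" "H \<subseteq> {g. contractive g}"
    "\<And>g. contractive g \<Longrightarrow> \<exists>h\<in>H. \<forall>p\<in>C. dist (g (fst p)) (h (fst p)) < 1 / m" by auto
  show ?thesis
  proof (intro exI[of _ H] conjI allI impI)
    fix g assume g: "contractive g"
    obtain h where h: "h \<in> H" "\<And>p. p \<in> C \<Longrightarrow> dist (g (fst p)) (h (fst p)) < 1 / m"
      using H(3)[OF g] by blast
    have dual: "g \<in> dual" "h \<in> dual" using g h H(2) by (auto simp: contractive_def)
    show "\<exists>h\<in>H. \<forall>z. norm (g (expansion C z) - h (expansion C z)) \<le> norm z"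
    proof (intro bexI[OF _ h(1)] allI)
      fix z
      have "norm (g (expansion C z) - h (expansion C z)) =
          norm (\<Sum>p\<in>C. snd p z * (g (fst p) - h (fst p)))"
        by (simp add: functional_expansion dual sum_subtractf right_diff_distrib)
      also have "\<dots> \<le> (\<Sum>p\<in>C. norm (snd p z) * (1 / m))"
      proof (rule sum_norm_le)
        fix p assume "p \<in> C"
        then have "norm (g (fst p) - h (fst p)) \<le> 1 / m" using h(2)[of p] by (simp add: dist_norm)
        then show "norm (snd p z * (g (fst p) - h (fst p))) \<le> norm (snd p z) * (1 / m)"
          unfolding norm_mult by (rule mult_left_mono) simp
      qed
      also have "\<dots> = (\<Sum>p\<in>C. norm (snd p z)) / m" by (simp add: sum_divide_distrib)
      also have "\<dots> \<le> norm z" using m(2)[of z] m(1) by (simp add: field_simps)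
      finally show "norm (g (expansion C z) - h (expansion C z)) \<le> norm z" .
    qed
  qed (use H in auto)
qed

lemma finite_vector_net:
  assumes B: "biorthogonal Q B" "finite B"
  shows "\<exists>Z. finite Z \<and> (\<forall>z\<in>Z. Q z = z \<and> norm z \<le> 1) \<and>
    (\<forall>z. Q z = z \<longrightarrow> norm z \<le> 1 \<longrightarrow> (\<exists>z'\<in>Z. norm (expansion B z - expansion B z') \<le> 1))"
proof -
  define m where "m = 1 + (\<Sum>p\<in>B. norm (fst p))"
  have m: "m > 0" unfolding m_def by (simp add: add_pos_nonneg sum_nonneg)
  have "\<exists>Z. finite Z \<and> Z \<subseteq> {z. Q z = z \<and> norm z \<le> 1} \<and>
      (\<forall>z\<in>{z. Q z = z \<and> norm z \<le> 1}. \<exists>z'\<in>Z. \<forall>p\<in>B. dist (snd p z) (snd p z') < 1 / m)"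
  proof (rule finite_net)
    fix p assume "p \<in> B"
    then obtain K where "K > 0" "\<And>x. norm (snd p x) \<le> norm x * K"
      using dual_bound biorthogonal_dual[OF B(1)] by blast
    then have "norm (snd p x) \<le> K" if "norm x \<le> 1" for x
    proof -
      have "norm x * K \<le> 1 * K" using that \<open>K > 0\<close> by (intro mult_right_mono) auto
      then show ?thesis using \<open>\<And>x. norm (snd p x) \<le> norm x * K\<close>[of x] by simp
    qed
    then show "bounded (snd p ` {z. Q z = z \<and> norm z \<le> 1})"
      unfolding bounded_iff by auto
  qed (use B m in auto)
  then obtain Z where Z: "finite Z" "Z \<subseteq> {z. Q z = z \<and> norm z \<le> 1}"
    "\<And>z. Q z = z \<Longrightarrow> norm z \<le> 1 \<Longrightarrow> \<exists>z'\<in>Z. \<forall>p\<in>B. dist (snd p z) (snd p z') < 1 / m" by auto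
  show ?thesis
  proof (intro exI[of _ Z] conjI allI impI)
    fix z assume z: "Q z = z" "norm z \<le> 1"
    obtain z' where z': "z' \<in> Z" "\<And>p. p \<in> B \<Longrightarrow> dist (snd p z) (snd p z') < 1 / m"
      using Z(3)[OF z] by blast
    have "norm (expansion B z - expansion B z') = norm (\<Sum>p\<in>B. smul (snd p z - snd p z') (fst p))"
      by (simp add: expansion_def sum_subtractf scale_left_diff_distrib)
    also have "\<dots> \<le> (\<Sum>p\<in>B. (1 / m) * norm (fst p))"
    proof (rule sum_norm_le)
      fix p assume "p \<in> B"
      then have "norm (snd p z - snd p z') \<le> 1 / m" using z'(2)[of p] by (simp add: dist_norm)
      then show "norm (smul (snd p z - snd p z') (fst p)) \<le> 1 / m * norm (fst p)"
        unfolding norm_smul by (rule mult_right_mono) simp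
    qed
    also have "\<dots> = (\<Sum>p\<in>B. norm (fst p)) / m" by (simp add: sum_divide_distrib)
    also have "\<dots> \<le> 1" using m by (simp add: m_def)
    finally show "\<exists>z'\<in>Z. norm (expansion B z - expansion B z') \<le> 1" using z'(1) by blast
  qed (use Z in auto)
qed

text \<open>
  A vector \<open>d\<close> outside the span is replaced by \<open>u = d - expansion C d\<close>, and the Hahn-Banach theorem
  gives a functional that is nonzero at \<open>u\<close>.
\<close>

lemma extend_vectors:
  assumes Q: "operator Q" "\<And>x. Q (Q x) = Q x" and C: "biorthogonal Q C" "finite C"
    and D: "finite D" "\<And>d. d \<in> D \<Longrightarrow> Q d = d"
  shows "\<exists>A. finite A \<and> A \<inter> C = {} \<and> biorthogonal Q (C \<union> A) \<and> (\<forall>d\<in>D. expansion (C \<union> A) d = d)"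
  using D
proof (induction D)
  case empty
  show ?case by (intro exI[of _ "{}"]) (use C in simp)
next
  case (insert d D)
  then obtain A where A: "finite A" "A \<inter> C = {}" "biorthogonal Q (C \<union> A)"
    "\<And>d. d \<in> D \<Longrightarrow> expansion (C \<union> A) d = d"
    by auto
  define C' where "C' = C \<union> A"
  have C': "biorthogonal Q C'" "finite C'" using A C by (auto simp: C'_def)
  define u where "u = d - expansion C' d"
  have u: "Q u = u" "expansion C' u = 0"
    by (simp_all add: u_def operator_diff[OF Q(1)] insert.prems expansion_range[OF C'(1) Q(1)]
        operator_diff[OF operator_expansion[OF C'(1)]] expansion_expansion[OF C' order_refl])
  show ?case
  proof (cases "u = 0")
    case True
    then show ?thesis using A by (intro exI[of _ A]) (auto simp: u_def C'_def)
  next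
    case False
    then obtain g where g: "g \<in> dual" "g u \<noteq> 0"
      using hahn_banach[of "{0}" u] by auto
    define h where "h = (\<lambda>x. (1 / g u) * g x)"
    have h: "h \<in> dual" "h u = 1"
      unfolding h_def using dual_cmult[OF g(1), of "1 / g u"] g(2) by auto
    define \<phi> where "\<phi> = (\<lambda>x. h (Q x - expansion C' x))"
    note ad = biorthogonal_adjoin[OF Q C' h(1) \<phi>_def u h(2)]
    show ?thesis
    proof (intro exI[of _ "insert (u, \<phi>) A"] conjI ballI)
      show "finite (insert (u, \<phi>) A)" using A by simp
      show "insert (u, \<phi>) A \<inter> C = {}" using A ad(1) by (auto simp: C'_def)
      show "biorthogonal Q (C \<union> insert (u, \<phi>) A)" using ad(2) by (simp add: C'_def)
      fix d' assume "d' \<in> insert d D"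
      moreover have "expansion (C \<union> insert (u, \<phi>) A) d = d"
      proof -
        have "expansion (insert (u, \<phi>) C') d = smul (\<phi> d) u + expansion C' d"
          unfolding expansion_def using C'(2) ad(1) by simp
        also have "\<phi> d = 1" using insert.prems h(2) by (simp add: \<phi>_def u_def)
        finally show ?thesis by (simp add: C'_def u_def)
      qed
      moreover have "expansion (C \<union> insert (u, \<phi>) A) d' = d'" if "d' \<in> D"
        using expansion_fixed_mono[OF ad(2) _ subset_insertI, of d'] C'(2) A(4)[OF that]
        by (simp add: C'_def)
      ultimately show "expansion (C \<union> insert (u, \<phi>) A) d' = d'" by blast
    qed
  qed
qed

end

section \<open>Coupling the pairs of a block\<close>

context separated_banach_space
begin

text \<open>
  The pairs in \<open>U\<close> are the ones still to be coupled with further pairs. The conclusion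
  says: if \<open>z\<close> and \<open>g\<close> have vanishing products on all pairs created from \<open>U\<close>, then either \<open>g\<close> is
  bounded on the expansion of \<open>z\<close> with respect to the untouched pairs, or \<open>g\<close> is tiny on each vector of \<open>U\<close>; how
  tiny is prescribed by \<open>m\<close>, which is so large that the terms of \<open>U\<close> with a tiny \<open>g e\<close> sum to at most \<open>norm z\<close>.

  In the induction step \<open>p = (e, f)\<close> is coupled with new pairs \<open>A\<close>, and then the
  remaining pairs \<open>U\<close> are handled inside the coupled system.
  If the second alternative holds for \<open>U\<close>, there are two cases. If some functional of \<open>A\<close> is nonzero at
  \<open>z\<close>, then \<open>g\<close> vanishes on a vector \<open>v + a e\<close>, so \<open>g e\<close> is tiny too. If all of them vanish at \<open>z\<close>, then \<open>A\<close> was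
  chosen so that \<open>g\<close> is bounded by 2 on the expansion of \<open>z\<close> along \<open>C\<close>, and the terms of \<open>p\<close> and \<open>U\<close> in it
  are zero and at most 1 respectively.
\<close>

lemma perturbed_extension:
  assumes Q: "operator Q" "\<And>x. Q (Q x) = Q x"
    and C: "biorthogonal Q C" "finite C" and U: "finite U" "U \<subseteq> C"
    and m: "m > 0" "\<And>z. (\<Sum>p\<in>U. norm (snd p z)) \<le> m * norm z"
  shows "\<exists>D. finite D \<and> biorthogonal Q D \<and> C - U \<subseteq> D \<and>
    (\<forall>d. expansion C d = d \<longrightarrow> expansion D d = d) \<and>
    (\<forall>z g. Q z = z \<longrightarrow> norm z \<le> 1 \<longrightarrow> contractive g \<longrightarrow>
      (\<forall>p\<in>D - (C - U). snd p z * g (fst p) = 0) \<longrightarrow>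
      norm (g (expansion (C - U) z)) \<le> 3 \<or> (\<forall>p\<in>U. m * norm (g (fst p)) \<le> 1))"
  using U C m(2)
proof (induction U arbitrary: C)
  case empty
  then show ?case by (intro exI[of _ C]) auto
next
  case (insert p U)
  define e f where "e = fst p" and "f = snd p"
  define E where "E = C - insert p U"
  note C = \<open>biorthogonal Q C\<close> \<open>finite C\<close>
  have pC: "p \<in> C" and UC: "U \<subseteq> C" using insert.prems by auto
  obtain H where H: "finite H" "\<And>h. h \<in> H \<Longrightarrow> contractive h"
    "\<And>g. contractive g \<Longrightarrow> \<exists>h\<in>H. \<forall>z. norm (g (expansion C z) - h (expansion C z)) \<le> norm z"
    using finite_functional_net[OF C] by blast
  have "H \<subseteq> dual" using H(2) by (auto simp: contractive_def)
  then obtain A where A: "finite A" "A \<inter> C = {}" "biorthogonal Q (C \<union> A)"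
    "\<And>h z. h \<in> H \<Longrightarrow> Q z = z \<Longrightarrow> (\<forall>q\<in>A. snd q z = 0) \<Longrightarrow> h z = h (expansion C z)"
    using extend_functionals[OF Q C H(1)] by blast
  \<comment> \<open>Large compared with the vectors of \<open>A\<close>, so that \<open>g (v + a e) = 0\<close> makes \<open>m * norm (g e)\<close> at most 1.\<close>
  define a where "a = 1 + (\<Sum>q\<in>A. m * norm (fst q))"
  have a: "a > 0" "\<And>q. q \<in> A \<Longrightarrow> m * norm (fst q) \<le> a"
  proof -
    show "a > 0" unfolding a_def using m(1) by (simp add: add_pos_nonneg sum_nonneg)
    fix q assume "q \<in> A"
    then have "m * norm (fst q) \<le> (\<Sum>q\<in>A. m * norm (fst q))"
      using A(1) m(1) by (intro member_le_sum) auto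
    then show "m * norm (fst q) \<le> a" by (simp add: a_def)
  qed
  \<comment> \<open>The coupled pairs \<open>(v + a e, \<phi>)\<close> and \<open>(e, f - a * sum \<phi>)\<close> are again biorthogonal.\<close>
  define shift where "shift q = (fst q + smul (of_real a) e, snd q)" for q :: "'a \<times> ('a \<Rightarrow> 'k)"
  define p' where "p' = (e, \<lambda>x. f x - of_real a * (\<Sum>q\<in>A. snd q x))"
  define C1 where "C1 = (C - {p}) \<union> insert p' (shift ` A)"

  have val: "snd r (fst q) = (if r = q then 1 else 0)" if "r \<in> C \<union> A" "q \<in> C \<union> A" for r q
    using biorthogonal_eq[OF A(3)] that by blast
  have dualA: "snd q \<in> dual" if "q \<in> C \<union> A" for q using biorthogonal_dual[OF A(3)] that by blast
  have fd: "f \<in> dual" using dualA pC by (simp add: f_def)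
  have fe: "f e = 1" using val[of p p] pC by (simp add: e_def f_def)
  have Ae: "snd q e = 0" if "q \<in> A" for q
    using val[of q p] that pC A(2) by (auto simp: e_def)
  have fA: "f (fst q) = 0" if "q \<in> A" for q
    using val[of p q] that pC A(2) by (auto simp: f_def)
  have Qe: "Q e = e" using biorthogonal_range[OF C(1) pC] by (simp add: e_def)
  have p'd: "snd p' \<in> dual"
    unfolding p'_def snd_conv by (intro dual_minus fd dual_cmult dual_sum_functionals dualA) auto
  have p'e: "snd p' e = 1" using fe Ae by (simp add: p'_def)
  have sumA: "(\<Sum>r\<in>A. snd r (fst q)) = 1" if "q \<in> A" for q
  proof -
    have "(\<Sum>r\<in>A. snd r (fst q)) = (\<Sum>r\<in>A. if r = q then 1 else 0)"
      using that by (intro sum.cong refl) (simp add: val)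
    then show ?thesis using that A(1) by simp
  qed
  have p's: "snd p' (fst (shift q)) = 0" if "q \<in> A" for q
  proof -
    have "snd p' (fst (shift q)) = snd p' (fst q) + of_real a * snd p' e"
      by (simp add: shift_def dual_add[OF p'd] dual_scale[OF p'd])
    also have "\<dots> = 0" unfolding p'e by (simp add: p'_def fA[OF that] sumA[OF that])
    finally show ?thesis .
  qed
  have sp': "snd (shift q) e = 0" if "q \<in> A" for q using Ae[OF that] by (simp add: shift_def)
  have ss: "snd (shift q) (fst (shift r)) = (if q = r then 1 else 0)" if "q \<in> A" "r \<in> A" for q r
    using that val[of q r] Ae[of q] dualA[of q] by (simp add: shift_def dual_add dual_scale)
  have new: "biorthogonal Q (insert p' (shift ` A))"
    unfolding biorthogonal_def
  proof (intro conjI ballI)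
    fix r assume r: "r \<in> insert p' (shift ` A)"
    have "snd (shift q) \<in> dual" if "q \<in> A" for q using dualA[of q] that by (simp add: shift_def)
    then show "snd r \<in> dual" using r p'd by blast
    have "Q (fst (shift q)) = fst (shift q)" if "q \<in> A" for q
      using Qe biorthogonal_range[OF A(3), of q] that
      by (simp add: shift_def operator_add[OF Q(1)] operator_scale[OF Q(1)])
    then show "Q (fst r) = fst r" using r Qe by (auto simp: p'_def)
    show "\<forall>x. snd r (Q x) = snd r x"
    proof
      fix x
      have absorb: "snd q (Q x) = snd q x" if "q \<in> C \<union> A" for q by (rule biorthogonal_absorb[OF A(3) that])
      then have "snd p' (Q x) = snd p' x" using pC by (simp add: p'_def f_def cong: sum.cong)
      moreover have "snd (shift q) (Q x) = snd (shift q) x" if "q \<in> A" for q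
        using absorb[of q] that by (simp add: shift_def)
      ultimately show "snd r (Q x) = snd r x" using r by blast
    qed
    fix q assume q: "q \<in> insert p' (shift ` A)"
    have fst': "fst p' = e" by (simp add: p'_def)
    have ne: "p' \<noteq> shift s" if "s \<in> A" for s using p'e sp'[OF that] by auto
    from r q consider "r = p'" "q = p'" | s where "s \<in> A" "r = p'" "q = shift s"
      | s where "s \<in> A" "r = shift s" "q = p'" | s t where "s \<in> A" "t \<in> A" "r = shift s" "q = shift t"
      by blast
    then show "snd r (fst q) = (if r = q then 1 else 0)"
    proof cases
      case 1
      then show ?thesis using p'e fst' by simp
    next
      case (2 s)
      then show ?thesis using p's ne by simp
    next
      case (3 s)
      then show ?thesis using sp' ne[of s] fst' by simp
    next
      case (4 s t)
      then show ?thesis using ss[of s t] ss[of s s] by auto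
    qed
  qed
  have old: "biorthogonal Q (C - {p})" by (rule biorthogonal_subset[OF C(1)]) blast
  have re: "snd r e = 0" if "r \<in> C - {p}" for r
    using val[of r p] that pC by (auto simp: e_def)
  have cross: "snd r (fst q) = 0 \<and> snd q (fst r) = 0"
    if r: "r \<in> C - {p}" and q: "q \<in> insert p' (shift ` A)" for r q
  proof -
    have Ar: "snd s (fst r) = 0" "snd r (fst s) = 0" if "s \<in> A" for s
      using val[of s r] val[of r s] that r A(2) by auto
    have fr: "f (fst r) = 0" using val[of p r] r pC by (auto simp: f_def)
    show ?thesis
      using q
    proof
      assume "q = p'"
      then show ?thesis using re[OF r] Ar fr by (simp add: p'_def)
    next
      assume "q \<in> shift ` A"
      then obtain s where s: "s \<in> A" "q = shift s" by blast
      then show ?thesis using re[OF r] Ar[OF s(1)] dualA[of r] r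
        by (simp add: shift_def dual_add dual_scale)
    qed
  qed
  have C1: "biorthogonal Q C1" "finite C1"
    unfolding C1_def using biorthogonal_Un[OF old new cross] C(2) A(1) by auto
  have notold: "r \<notin> C - {p}" if "r \<in> insert p' (shift ` A)" for r
    using cross[OF _ that, of r] biorthogonal_eq[OF new that that] by auto
  have UC1: "U \<subseteq> C1" using UC insert.hyps by (auto simp: C1_def)
  have bound: "(\<Sum>p\<in>U. norm (snd p z)) \<le> m * norm z" for z
  proof -
    have "(\<Sum>q\<in>insert p U. norm (snd q z)) = norm (snd p z) + (\<Sum>q\<in>U. norm (snd q z))"
      using insert.hyps by simp
    then show ?thesis using insert.prems(4)[of z] norm_ge_zero[of "snd p z"] by linarith
  qed
  from insert.IH[OF UC1 C1 bound]
  obtain D where D: "finite D" "biorthogonal Q D" "C1 - U \<subseteq> D"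
    and Dfix: "\<forall>d. expansion C1 d = d \<longrightarrow> expansion D d = d"
    and Dkill: "\<forall>z g. Q z = z \<longrightarrow> norm z \<le> 1 \<longrightarrow> contractive g \<longrightarrow>
      (\<forall>p\<in>D - (C1 - U). snd p z * g (fst p) = 0) \<longrightarrow>
      norm (g (expansion (C1 - U) z)) \<le> 3 \<or> (\<forall>p\<in>U. m * norm (g (fst p)) \<le> 1)"
    by (elim exE conjE) (rule that)
  have EC1: "E \<subseteq> C1 - U" by (auto simp: E_def C1_def)
  have newD: "r \<in> D - E" if "r \<in> insert p' (shift ` A)" for r
  proof -
    have "r \<notin> U" using notold[OF that] UC insert.hyps by blast
    then show ?thesis using that D(3) notold[OF that] by (auto simp: C1_def E_def)
  qed
  show ?case
    unfolding E_def[symmetric]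
  proof (intro exI[of _ D] conjI allI impI)
    show "finite D" "biorthogonal Q D" by fact+
    show "E \<subseteq> D" using EC1 D(3) by blast
    fix d assume d: "expansion C d = d"
    have "expansion C1 (fst r) = fst r" if "r \<in> C" for r
    proof (cases "r = p")
      case True
      then show ?thesis using expansion_fst[OF C1, of p'] by (simp add: C1_def p'_def e_def)
    next
      case False
      then show ?thesis using expansion_fst[OF C1, of r] that by (simp add: C1_def)
    qed
    then have "expansion C1 d = d" using expansion_transfer[OF C1(1), of C d] d by simp
    then show "expansion D d = d" by (rule Dfix[rule_format])
  next
    fix z g assume z: "Q z = z" "norm z \<le> 1" and g: "contractive g"
      and prod: "\<forall>p\<in>D - E. snd p z * g (fst p) = 0"
    have gd: "g \<in> dual" and gle: "\<And>v. norm (g v) \<le> norm v" using g by (auto simp: contractive_def)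
    \<comment> \<open>The coupled pairs contribute nothing, because their products vanish.\<close>
    have same: "g (expansion (C1 - U) z) = g (expansion E z)"
      unfolding functional_expansion[OF gd]
      by (rule sum.mono_neutral_right) (use C1 EC1 prod D(3) in auto)
    have "norm (g (expansion E z)) \<le> 3 \<or> (\<forall>p\<in>U. m * norm (g (fst p)) \<le> 1)"
      using Dkill[rule_format, OF z g] prod EC1 same by auto
    then consider (small) "norm (g (expansion E z)) \<le> 3" | (rest) "\<And>p. p \<in> U \<Longrightarrow> m * norm (g (fst p)) \<le> 1"
      by blast
    then show "norm (g (expansion E z)) \<le> 3 \<or> (\<forall>p\<in>insert p U. m * norm (g (fst p)) \<le> 1)"
    proof cases
      case rest
      show ?thesis
      proof (cases "\<forall>q\<in>A. snd q z = 0")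
        case False
        then obtain q where q: "q \<in> A" "snd q z \<noteq> 0" by blast
        have "snd (shift q) z * g (fst (shift q)) = 0" using prod newD q(1) by blast
        then have "g (fst q) + of_real a * g e = 0"
          using q(2) by (simp add: shift_def dual_add[OF gd] dual_scale[OF gd])
        then have "norm (of_real a * g e) = norm (g (fst q))"
          by (metis add_eq_0_iff norm_minus_cancel)
        then have "a * norm (g e) \<le> norm (fst q)" using a(1) gle[of "fst q"] by (simp add: norm_mult)
        then have "a * (m * norm (g e)) \<le> m * norm (fst q)"
          using m(1) mult_left_mono[of "a * norm (g e)" "norm (fst q)" m] by (simp add: mult_ac)
        also have "\<dots> \<le> a * 1" using a(2)[OF q(1)] by simp
        finally have "m * norm (g e) \<le> 1" using a(1) by (simp only: mult_le_cancel_left_pos)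
        then show ?thesis using rest by (auto simp: e_def)
      next
        case True
        obtain h where h: "h \<in> H" "\<And>z. norm (g (expansion C z) - h (expansion C z)) \<le> norm z"
          using H(3)[OF g] by blast
        have "norm (h (expansion C z)) \<le> 1"
        proof -
          have "h z = h (expansion C z)" by (rule A(4)[OF h(1) z(1) True])
          moreover have "norm (h z) \<le> norm z" using H(2)[OF h(1)] by (simp add: contractive_def)
          ultimately show ?thesis using z(2) by simp
        qed
        then have 2: "norm (g (expansion C z)) \<le> 2"
          using h(2)[of z] z(2) norm_triangle_sub[of "g (expansion C z)" "h (expansion C z)"] by simp
        \<comment> \<open>At \<open>z\<close> the coupled functional agrees with \<open>f\<close>.\<close>
        have pz: "f z * g e = 0"
        proof -
          have "snd p' z * g (fst p') = 0" using prod newD by blast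
          then show ?thesis using True by (simp add: p'_def)
        qed
        have CE: "C = E \<union> insert p U" "E \<inter> insert p U = {}" using pC UC by (auto simp: E_def)
        have fin: "finite E" "finite (insert p U)" using C(2) insert.hyps by (auto simp: E_def)
        have "g (expansion C z) = g (expansion E z) + (\<Sum>q\<in>insert p U. snd q z * g (fst q))"
          unfolding functional_expansion[OF gd]
          by (subst CE(1)) (rule sum.union_disjoint[OF fin CE(2)])
        also have "(\<Sum>q\<in>insert p U. snd q z * g (fst q)) = (\<Sum>q\<in>U. snd q z * g (fst q))"
          using insert.hyps pz by (simp add: e_def f_def)
        finally have split: "g (expansion E z) = g (expansion C z) - (\<Sum>q\<in>U. snd q z * g (fst q))"
          by simp
        have "norm (\<Sum>q\<in>U. snd q z * g (fst q)) \<le> (\<Sum>q\<in>U. norm (snd q z) * (1 / m))"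
        proof (rule sum_norm_le)
          fix q assume "q \<in> U"
          then have "norm (g (fst q)) \<le> 1 / m" using rest[of q] m(1) by (simp add: field_simps)
          then show "norm (snd q z * g (fst q)) \<le> norm (snd q z) * (1 / m)"
            unfolding norm_mult by (rule mult_left_mono) simp
        qed
        also have "\<dots> = (\<Sum>q\<in>U. norm (snd q z)) / m" by (simp add: sum_divide_distrib)
        also have "\<dots> \<le> norm z" using bound[of z] m(1) by (simp add: field_simps)
        finally have "norm (g (expansion E z)) \<le> 2 + norm z"
          unfolding split
          using 2 norm_triangle_ineq4[of "g (expansion C z)" "\<Sum>q\<in>U. snd q z * g (fst q)"] by linarith
        then show ?thesis using z(2) by simp
      qed
    qed blast
  qed
qed

text \<open>
  If the second alternative of \<open>perturbed_extension\<close> holds, take \<open>z'\<close> in the net \<open>Z\<close> for which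
  \<open>expansion B z'\<close> is close to \<open>expansion B z\<close>.
  The difference \<open>z' - expansion B z'\<close> is in the span of \<open>K\<close>, where \<open>g\<close> is tiny, so the three summands
  of \<open>g (expansion B z)\<close> are each at most 1.
\<close>

lemma bounded_extension:
  assumes Q: "operator Q" "\<And>x. Q (Q x) = Q x" and B: "biorthogonal Q B" "finite B"
    and d: "Q d = d"
  shows "\<exists>D. finite D \<and> biorthogonal Q D \<and> B \<subseteq> D \<and> expansion D d = d \<and>
    (\<forall>z g. Q z = z \<longrightarrow> contractive g \<longrightarrow> (\<forall>p\<in>D - B. snd p z * g (fst p) = 0) \<longrightarrow>
      norm (g (expansion B z)) \<le> 3 * norm z)"
proof -
  obtain Z where Z: "finite Z" "\<And>z. z \<in> Z \<Longrightarrow> Q z = z" "\<And>z. z \<in> Z \<Longrightarrow> norm z \<le> 1"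
    "\<And>z. Q z = z \<Longrightarrow> norm z \<le> 1 \<Longrightarrow> \<exists>z'\<in>Z. norm (expansion B z - expansion B z') \<le> 1"
    using finite_vector_net[OF B] by blast
  obtain K where K: "finite K" "K \<inter> B = {}" "biorthogonal Q (B \<union> K)"
    "\<And>v. v \<in> insert d Z \<Longrightarrow> expansion (B \<union> K) v = v"
  proof -
    have "finite (insert d Z)" "\<And>v. v \<in> insert d Z \<Longrightarrow> Q v = v" using Z d by auto
    from extend_vectors[OF Q B this] show thesis using that by blast
  qed
  have Kb: "biorthogonal Q K" by (rule biorthogonal_subset[OF K(3)]) blast
  obtain m where m: "m > 0" "\<And>z. (\<Sum>p\<in>K. norm (snd p z)) \<le> m * norm z"
    using coefficient_bounds[OF Kb K(1)] by blast
  have BK: "B \<union> K - K = B" using K(2) by blast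
  have "finite (B \<union> K)" "K \<subseteq> B \<union> K" using B(2) K(1) by auto
  from perturbed_extension[OF Q K(3) this(1) K(1) this(2) m, unfolded BK]
  obtain D where D: "finite D" "biorthogonal Q D" "B \<subseteq> D"
    and Dfix: "\<forall>v. expansion (B \<union> K) v = v \<longrightarrow> expansion D v = v"
    and Dkill: "\<forall>z g. Q z = z \<longrightarrow> norm z \<le> 1 \<longrightarrow> contractive g \<longrightarrow>
      (\<forall>p\<in>D - B. snd p z * g (fst p) = 0) \<longrightarrow>
      norm (g (expansion B z)) \<le> 3 \<or> (\<forall>p\<in>K. m * norm (g (fst p)) \<le> 1)"
    by (elim exE conjE) (rule that)
  have unit: "norm (g (expansion B z)) \<le> 3"
    if z: "Q z = z" "norm z \<le> 1" and g: "contractive g"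
      and prod: "\<And>p. p \<in> D - B \<Longrightarrow> snd p z * g (fst p) = 0" for z g
    using Dkill[rule_format, OF z g prod]
  proof
    assume small: "\<forall>p\<in>K. m * norm (g (fst p)) \<le> 1"
    have gd: "g \<in> dual" and gle: "\<And>v. norm (g v) \<le> norm v" using g by (auto simp: contractive_def)
    obtain z' where z': "z' \<in> Z" "norm (expansion B z - expansion B z') \<le> 1" using Z(4)[OF z] by blast
    have "norm (g (expansion K z')) \<le> (\<Sum>p\<in>K. norm (snd p z') * (1 / m))"
      unfolding functional_expansion[OF gd]
    proof (rule sum_norm_le)
      fix q assume "q \<in> K"
      then have "norm (g (fst q)) \<le> 1 / m" using small m(1) by (simp add: field_simps)
      then show "norm (snd q z' * g (fst q)) \<le> norm (snd q z') * (1 / m)"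
        unfolding norm_mult by (rule mult_left_mono) simp
    qed
    also have "\<dots> = (\<Sum>p\<in>K. norm (snd p z')) / m" by (simp add: sum_divide_distrib)
    also have "\<dots> \<le> norm z'" using m(2)[of z'] m(1) by (simp add: field_simps)
    finally have 1: "norm (g (expansion K z')) \<le> 1" using Z(3)[OF z'(1)] by simp
    have "z' = expansion B z' + expansion K z'"
      using K(4)[of z'] z'(1) expansion_Un_disjoint[OF B(2) K(1), of z'] K(2) by (simp add: Int_commute)
    then have "g z' = g (expansion B z') + g (expansion K z')" using dual_add[OF gd] by metis
    then have "g (expansion B z) = g (expansion B z - expansion B z') + g z' - g (expansion K z')"
      using dual_diff[OF gd, of "expansion B z" "expansion B z'"] by simp
    moreover have "norm (g (expansion B z - expansion B z')) \<le> 1" using gle z'(2) order_trans by blast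
    moreover have "norm (g z') \<le> 1" using gle Z(3)[OF z'(1)] order_trans by blast
    ultimately show ?thesis
      using 1 norm_triangle_ineq4[of "g (expansion B z - expansion B z') + g z'" "g (expansion K z')"]
        norm_triangle_ineq[of "g (expansion B z - expansion B z')" "g z'"] by simp
  qed blast
  have "norm (g (expansion B z)) \<le> 3 * norm z"
    if z: "Q z = z" and g: "contractive g" and prod: "\<And>p. p \<in> D - B \<Longrightarrow> snd p z * g (fst p) = 0" for z g
  proof (cases "z = 0")
    case True
    then show ?thesis using operator_zero[OF operator_expansion[OF B(1)]] g by (simp add: contractive_def dual_zero)
  next
    case False
    define c where "c = (of_real (1 / norm z) :: 'k)"
    have "norm (g (expansion B (smul c z))) \<le> 3"
    proof (rule unit[OF _ _ g])
      show "Q (smul c z) = smul c z" using z operator_scale[OF Q(1)] by simp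
      show "norm (smul c z) \<le> 1" using False by (simp add: c_def norm_smul norm_divide)
      fix p assume "p \<in> D - B"
      then show "snd p (smul c z) * g (fst p) = 0"
        using prod[of p] biorthogonal_dual[OF D(2), of p] by (simp add: dual_scale)
    qed
    also have "g (expansion B (smul c z)) = c * g (expansion B z)"
      using g operator_scale[OF operator_expansion[OF B(1)]] by (simp add: contractive_def dual_scale)
    finally show ?thesis using False by (simp add: c_def norm_mult norm_divide field_simps)
  qed
  then show ?thesis using D Dfix[rule_format, of d] K(4)[of d] by (intro exI[of _ D]) auto
qed

end

section \<open>Strong systems in separable ranges\<close>

context separated_banach_space
begin

definition strong_system :: "('a \<Rightarrow> 'a) \<Rightarrow> ('a \<times> ('a \<Rightarrow> 'k)) set \<Rightarrow> bool" where
  "strong_system Q E \<longleftrightarrow> biorthogonal Q E \<and>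
    (\<forall>x. Q x = x \<longrightarrow> x \<in> closure (span (fst ` {p\<in>E. snd p x \<noteq> 0})))"

text \<open>
  Terenzi's theorem, relative to a projection with separable range: iterate \<open>bounded_extension\<close> while
  absorbing a dense sequence.
\<close>

theorem strong_system_separable:
  assumes Q: "operator Q" "\<And>x. Q (Q x) = Q x" and sep: "separable_set (range Q)"
  shows "\<exists>E. strong_system Q E"
proof -
  obtain T where T: "countable T" "T \<subseteq> range Q" "range Q \<subseteq> closure T"
    using sep by (auto simp: separable_set_def)
  then have "T \<noteq> {}" by auto
  define d where "d = from_nat_into T"
  have dT: "range d = T" unfolding d_def using T(1) \<open>T \<noteq> {}\<close> by (rule range_from_nat_into[rotated])
  have dQ: "Q (d n) = d n" for n using T(2) dT Q(2) by (metis imageE range_eqI subsetD)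
  let ?P = "\<lambda>(n::nat) B. finite B \<and> biorthogonal Q B"
  let ?R = "\<lambda>n B D. B \<subseteq> D \<and> expansion D (d n) = d n \<and>
    (\<forall>z g. Q z = z \<longrightarrow> contractive g \<longrightarrow> (\<forall>p\<in>D - B. snd p z * g (fst p) = 0) \<longrightarrow>
      norm (g (expansion B z)) \<le> 3 * norm z)"
  have "\<exists>B. \<forall>n. ?P n (B n) \<and> ?R n (B n) (B (Suc n))"
  proof (rule dependent_nat_choice)
    show "\<exists>B. ?P 0 B" by (intro exI[of _ "{}"]) (simp add: biorthogonal_def)
    fix B n assume "?P n B"
    then show "\<exists>D. ?P (Suc n) D \<and> ?R n B D" using bounded_extension[OF Q, of B "d n"] dQ by blast
  qed
  then obtain B where B: "\<And>n. finite (B n)" "\<And>n. biorthogonal Q (B n)" "\<And>n. B n \<subseteq> B (Suc n)"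
    "\<And>n. expansion (B (Suc n)) (d n) = d n"
    and kill: "\<And>n z g. Q z = z \<Longrightarrow> contractive g \<Longrightarrow>
      (\<forall>p\<in>B (Suc n) - B n. snd p z * g (fst p) = 0) \<Longrightarrow> norm (g (expansion (B n) z)) \<le> 3 * norm z"
    by metis
  have mono: "B i \<subseteq> B j" if "i \<le> j" for i j using lift_Suc_mono_le[of B] B(3) that by blast
  define E where "E = (\<Union>n. B n)"
  have E: "biorthogonal Q E"
    unfolding biorthogonal_def
  proof (intro conjI ballI)
    fix p assume "p \<in> E"
    then obtain i where i: "p \<in> B i" by (auto simp: E_def)
    show "snd p \<in> dual" "Q (fst p) = fst p" "\<forall>x. snd p (Q x) = snd p x"
      using biorthogonal_dual[OF B(2) i] biorthogonal_range[OF B(2) i] biorthogonal_absorb[OF B(2) i] by auto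
    fix q assume "q \<in> E"
    then obtain j where "q \<in> B j" by (auto simp: E_def)
    then have "p \<in> B (max i j)" "q \<in> B (max i j)" using i mono[of i "max i j"] mono[of j "max i j"] by auto
    then show "snd p (fst q) = (if p = q then 1 else 0)" by (rule biorthogonal_eq[OF B(2)])
  qed
  have "x \<in> closure (span (fst ` {p\<in>E. snd p x \<noteq> 0}))" (is "x \<in> ?W") if x: "Q x = x" for x
  proof (rule ccontr)
    assume nx: "x \<notin> ?W"
    have "subspace ?W" by (intro subspace_closure subspace_span)
    then obtain g0 where g0: "g0 \<in> dual" "\<And>y. y \<in> ?W \<Longrightarrow> g0 y = 0" "g0 x \<noteq> 0"
      using hahn_banach[OF _ closed_closure nx] by blast
    obtain k where k: "k > 0" "\<And>v. norm (g0 v) \<le> norm v * k" using dual_bound[OF g0(1)] by blast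
    define g where "g v = of_real (1 / k) * g0 v" for v
    have g: "contractive g"
      unfolding contractive_def g_def using dual_cmult[OF g0(1), of "of_real (1 / k)"] k
      by (auto simp: norm_mult norm_divide field_simps)
    have gd: "g \<in> dual" and gle: "\<And>v. norm (g v) \<le> norm v" using g by (auto simp: contractive_def)
    have prod: "snd p x * g (fst p) = 0" if "p \<in> E" for p
    proof (cases "snd p x = 0")
      case False
      then have "fst p \<in> ?W" using that closure_subset span_superset by fastforce
      then show ?thesis using g0(2) by (simp add: g_def)
    qed simp
    have "norm (g x) \<le> 4 * \<epsilon>" if \<epsilon>: "\<epsilon> > 0" for \<epsilon>
    proof -
      have "x \<in> closure T" using T(3) x by (metis rangeI subsetD)
      then obtain n where n: "dist (d n) x < \<epsilon>" using \<epsilon> dT unfolding closure_approachable by blast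
      define y z m where "y = d n" and "z = x - d n" and "m = Suc n"
      have ym: "expansion (B m) y = y" using B(4)[of n] by (simp add: y_def m_def)
      have Qz: "Q z = z" using x dQ[of n] by (simp add: z_def operator_diff[OF Q(1)])
      have nz: "norm z \<le> \<epsilon>" using n by (simp add: z_def dist_norm norm_minus_commute)
      \<comment> \<open>The new functionals vanish at \<open>y\<close>, so \<open>z = x - y\<close> has the same new coefficients as \<open>x\<close>.\<close>
      have "\<forall>p\<in>B (Suc m) - B m. snd p z * g (fst p) = 0"
      proof
        fix p assume p: "p \<in> B (Suc m) - B m"
        have "snd p y = snd p (expansion (B m) y)" using ym by simp
        also have "\<dots> = 0"
          using coefficient_expansion[OF B(2) B(1) B(3)[of m], of p y] p by simp
        finally have "snd p z = snd p x"
          using dual_diff[OF biorthogonal_dual[OF B(2)], of p "Suc m" x y] p by (simp add: z_def y_def)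
        then show "snd p z * g (fst p) = 0" using prod[of p] p by (auto simp: E_def)
      qed
      then have kz: "norm (g (expansion (B m) z)) \<le> 3 * \<epsilon>"
        using kill[OF Qz g, of m] nz by simp
      have "g (expansion (B m) x) = 0"
        unfolding functional_expansion[OF gd] using prod by (intro sum.neutral) (auto simp: E_def)
      moreover have "expansion (B m) x = y + expansion (B m) z"
        using operator_add[OF operator_expansion[OF B(2)], of m y z] ym by (simp add: y_def z_def)
      ultimately have "g y = - g (expansion (B m) z)" using dual_add[OF gd] by (metis add_eq_0_iff2)
      moreover have "g x = g z + g y" using dual_add[OF gd, of z y] by (simp add: z_def y_def)
      ultimately have "norm (g x) \<le> norm (g z) + norm (g (expansion (B m) z))"
        by (simp add: norm_triangle_ineq4)
      then show ?thesis using kz gle[of z] nz by linarith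
    qed
    \<comment> \<open>The estimate halves \<open>norm (g x)\<close> for this choice of \<open>\<epsilon>\<close>.\<close>
    from this[of "norm (g x) / 8"] have "g x = 0" by (cases "g x = 0") auto
    then show False using g0(3) k(1) by (simp add: g_def)
  qed
  then show ?thesis using E by (auto simp: strong_system_def)
qed

end

section \<open>Closure under countably many operations\<close>

unbundle cardinal_syntax

definition hull_step :: "('s \<Rightarrow> 's \<Rightarrow> 's) set \<Rightarrow> 's set \<Rightarrow> 's set" where
  "hull_step \<Phi> X = X \<union> (\<lambda>(\<phi>, s, t). \<phi> s t) ` (\<Phi> \<times> X \<times> X)"

definition op_hull :: "('s \<Rightarrow> 's \<Rightarrow> 's) set \<Rightarrow> 's set \<Rightarrow> 's set" where
  "op_hull \<Phi> X = (\<Union>n. (hull_step \<Phi> ^^ n) X)"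

definition op_closed :: "('s \<Rightarrow> 's \<Rightarrow> 's) set \<Rightarrow> 's set \<Rightarrow> bool" where
  "op_closed \<Phi> X \<longleftrightarrow> (\<forall>\<phi>\<in>\<Phi>. \<forall>s\<in>X. \<forall>t\<in>X. \<phi> s t \<in> X)"

lemma op_hull_superset: "X \<subseteq> op_hull \<Phi> X"
proof -
  have "(hull_step \<Phi> ^^ 0) X \<subseteq> op_hull \<Phi> X" unfolding op_hull_def by blast
  then show ?thesis by simp
qed

lemma op_hull_closed: "op_closed \<Phi> (op_hull \<Phi> X)"
  unfolding op_closed_def
proof (intro ballI)
  fix \<phi> s t assume *: "\<phi> \<in> \<Phi>" "s \<in> op_hull \<Phi> X" "t \<in> op_hull \<Phi> X"
  let ?H = "\<lambda>n. (hull_step \<Phi> ^^ n) X"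
  have "?H n \<subseteq> ?H (Suc n)" for n by (auto simp: hull_step_def)
  then have mono: "?H i \<subseteq> ?H j" if "i \<le> j" for i j using lift_Suc_mono_le[of ?H] that by blast
  obtain i j where "s \<in> ?H i" "t \<in> ?H j" using * by (auto simp: op_hull_def)
  then have "s \<in> ?H (max i j)" "t \<in> ?H (max i j)"
    using mono[of i "max i j"] mono[of j "max i j"] by auto
  then have "\<phi> s t \<in> ?H (Suc (max i j))" using *(1) by (force simp: hull_step_def)
  then show "\<phi> s t \<in> op_hull \<Phi> X" unfolding op_hull_def by blast
qed

lemma op_hull_minimal:
  assumes "X \<subseteq> M" "op_closed \<Phi> M" shows "op_hull \<Phi> X \<subseteq> M"
proof -
  have "(hull_step \<Phi> ^^ n) X \<subseteq> M" for n
  proof (induction n)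
    case (Suc n)
    then show ?case using assms(2) by (auto simp: hull_step_def op_closed_def subset_iff)
  qed (use assms in simp)
  then show ?thesis by (auto simp: op_hull_def)
qed

lemma op_hull_mono: "X \<subseteq> Y \<Longrightarrow> op_hull \<Phi> X \<subseteq> op_hull \<Phi> Y"
  using op_hull_minimal[OF _ op_hull_closed] op_hull_superset by (metis order_trans)

lemma countable_card_of_nat: "countable A \<longleftrightarrow> |A| \<le>o |UNIV :: nat set|"
  by (simp add: countable_def flip: card_of_ordLeq)

lemma card_op_hull:
  assumes "countable \<Phi>"
  shows "|op_hull \<Phi> X| \<le>o |X <+> (UNIV :: nat set)|"
proof -
  let ?S = "X <+> (UNIV :: nat set)"
  have inf: "infinite ?S" by simp
  have nat: "|UNIV :: nat set| \<le>o |?S|" by (rule card_of_Plus2)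
  have "|\<Phi>| \<le>o |UNIV :: nat set|" using assms countable_card_of_nat by blast
  then have \<Phi>: "|\<Phi>| \<le>o |?S|" using nat by (rule ordLeq_transitive)
  have "|(hull_step \<Phi> ^^ n) X| \<le>o |?S|" for n
  proof (induction n)
    case 0
    show ?case by (simp add: card_of_Plus1)
  next
    case (Suc n)
    let ?Y = "(hull_step \<Phi> ^^ n) X"
    have "|?Y \<times> ?Y| \<le>o |?S|"
      by (rule card_of_Times_ordLeq_infinite_Field[OF _ Suc Suc]) (simp_all only: Field_card_of inf card_of_card_order_on simp_thms)
    then have "|\<Phi> \<times> ?Y \<times> ?Y| \<le>o |?S|"
      by (intro card_of_Times_ordLeq_infinite_Field[OF _ \<Phi>]) (simp_all only: Field_card_of inf card_of_card_order_on simp_thms)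
    then have "|(\<lambda>(\<phi>, s, t). \<phi> s t) ` (\<Phi> \<times> ?Y \<times> ?Y)| \<le>o |?S|"
      by (rule ordLeq_transitive[OF card_of_image])
    then have "|?Y \<union> (\<lambda>(\<phi>, s, t). \<phi> s t) ` (\<Phi> \<times> ?Y \<times> ?Y)| \<le>o |?S|"
      by (intro card_of_Un_ordLeq_infinite_Field[OF _ Suc]) (simp_all only: Field_card_of inf card_of_card_order_on simp_thms)
    then show ?case by (simp only: funpow.simps o_apply hull_step_def[of \<Phi> ?Y])
  qed
  then show ?thesis
    unfolding op_hull_def by (intro card_of_UNION_ordLeq_infinite[OF inf nat] ballI)
qed

text \<open>
  The hull of \<open>X\<close> is a countable union of sets of at most the size of \<open>X\<close> and a countable set together.
\<close>

lemma card_op_hull_less: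
  assumes "countable \<Phi>" "|X| <o |B|" "uncountable B"
  shows "|op_hull \<Phi> X| <o |B|"
proof -
  have "infinite B" using assms(3) countable_finite by blast
  moreover have "|UNIV :: nat set| <o |B|"
    using assms(3) countable_card_of_nat[of B]
    by (simp add: not_ordLeq_iff_ordLess[OF card_of_Well_order card_of_Well_order])
  ultimately have "|X <+> (UNIV :: nat set)| <o |B|"
    using assms(2) by (intro card_of_Plus_ordLess_infinite)
  then show ?thesis using card_op_hull[OF assms(1)] ordLeq_ordLess_trans by blast
qed

section \<open>Projections attached to sets of indices\<close>

text \<open>
  A uniformly bounded skeleton, with a choice of upper bounds. The suprema of increasing sequences
  enter through the Cauchy condition.
\<close>

locale bounded_skeleton = separated_banach_space smul
  for smul :: "'k::{real_normed_field,heine_borel} \<Rightarrow> 'a::banach \<Rightarrow> 'a" +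
  fixes G :: "'s set" and le :: "'s rel" and P :: "'s \<Rightarrow> 'a \<Rightarrow> 'a" and N :: real
    and ub :: "'s \<Rightarrow> 's \<Rightarrow> 's"
  assumes le_refl: "s \<in> G \<Longrightarrow> (s, s) \<in> le"
    and le_trans: "(r, s) \<in> le \<Longrightarrow> (s, t) \<in> le \<Longrightarrow> (r, t) \<in> le"
    and ub: "s \<in> G \<Longrightarrow> t \<in> G \<Longrightarrow> ub s t \<in> G" "s \<in> G \<Longrightarrow> t \<in> G \<Longrightarrow> (s, ub s t) \<in> le"
      "s \<in> G \<Longrightarrow> t \<in> G \<Longrightarrow> (t, ub s t) \<in> le"
    and operator_P: "s \<in> G \<Longrightarrow> operator (P s)"
    and bound_P: "s \<in> G \<Longrightarrow> norm (P s x) \<le> N * norm x"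
    and P_P: "s \<in> G \<Longrightarrow> t \<in> G \<Longrightarrow> (s, t) \<in> le \<Longrightarrow> P s (P t x) = P s x"
      "s \<in> G \<Longrightarrow> t \<in> G \<Longrightarrow> (s, t) \<in> le \<Longrightarrow> P t (P s x) = P s x"
    and separable_P: "s \<in> G \<Longrightarrow> separable_set (range (P s))"
    and Cauchy_P: "(\<And>n. \<sigma> n \<in> G) \<Longrightarrow> (\<And>n. (\<sigma> n, \<sigma> (Suc n)) \<in> le) \<Longrightarrow> Cauchy (\<lambda>n. P (\<sigma> n) x)"
    and cover_P: "\<exists>s\<in>G. P s x = x"
begin

definition ub_closed :: "'s set \<Rightarrow> bool" where
  "ub_closed A \<longleftrightarrow> A \<subseteq> G \<and> (\<forall>s\<in>A. \<forall>t\<in>A. ub s t \<in> A)"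

text \<open>
  The filter of final segments of \<open>A\<close>.
\<close>

definition tail :: "'s set \<Rightarrow> 's filter" where
  "tail A = (INF s\<in>A. principal {t\<in>A. (s, t) \<in> le})"

text \<open>
  The empty set is given the projection 0 explicitly, because there is no limit along it; it is the bottom of
  the chains in \<open>strong_system_exists\<close>.
\<close>

definition proj :: "'s set \<Rightarrow> 'a \<Rightarrow> 'a" where
  "proj A x = (if A = {} then 0 else Lim (tail A) (\<lambda>t. P t x))"

lemma eventually_tail:
  assumes "ub_closed A" "A \<noteq> {}"
  shows "eventually R (tail A) \<longleftrightarrow> (\<exists>s\<in>A. \<forall>t\<in>A. (s, t) \<in> le \<longrightarrow> R t)"
proof -
  have "\<exists>r\<in>A. principal {w\<in>A. (r, w) \<in> le} \<le> inf (principal {w\<in>A. (s, w) \<in> le}) (principal {w\<in>A. (t, w) \<in> le})"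
    if "s \<in> A" "t \<in> A" for s t
  proof (rule bexI[of _ "ub s t"])
    show "ub s t \<in> A" using assms that by (auto simp: ub_closed_def)
    have "s \<in> G" "t \<in> G" using assms that by (auto simp: ub_closed_def)
    then show "principal {w\<in>A. (ub s t, w) \<in> le} \<le> inf (principal {w\<in>A. (s, w) \<in> le}) (principal {w\<in>A. (t, w) \<in> le})"
      using ub le_trans by (auto simp: inf_principal) blast+
  qed
  then show ?thesis
    unfolding tail_def using assms(2)
    by (subst eventually_INF_base) (auto simp: eventually_principal)
qed

lemma tail_neq_bot: "ub_closed A \<Longrightarrow> A \<noteq> {} \<Longrightarrow> tail A \<noteq> bot"
  using eventually_tail[of A "\<lambda>_. False"] le_refl unfolding trivial_limit_def ub_closed_def by blast

lemma eventually_tail_ge: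
  "ub_closed A \<Longrightarrow> s \<in> A \<Longrightarrow> eventually (\<lambda>t. t \<in> A \<and> (s, t) \<in> le) (tail A)"
  by (subst eventually_tail) auto

text \<open>
  If the net were not Cauchy, it would oscillate along an increasing sequence of indices.
\<close>

lemma tendsto_proj:
  assumes A: "ub_closed A" "A \<noteq> {}"
  shows "((\<lambda>t. P t x) \<longlongrightarrow> proj A x) (tail A)"
proof -
  have AG: "A \<subseteq> G" using A by (simp add: ub_closed_def)
  have small: "\<exists>s\<in>A. \<forall>t\<in>A. (s, t) \<in> le \<longrightarrow> dist (P t x) (P s x) < e" if "e > 0" for e
  proof (rule ccontr)
    assume "\<not> ?thesis"
    then have ex: "\<exists>t\<in>A. (s, t) \<in> le \<and> dist (P t x) (P s x) \<ge> e" if "s \<in> A" for s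
      using that by (meson not_less)
    have "\<exists>\<sigma>. \<forall>n. \<sigma> n \<in> A \<and> ((\<sigma> n, \<sigma> (Suc n)) \<in> le \<and> dist (P (\<sigma> (Suc n)) x) (P (\<sigma> n) x) \<ge> e)"
      by (rule dependent_nat_choice) (use A(2) ex in blast)+
    then obtain \<sigma> where \<sigma>: "\<And>n. \<sigma> n \<in> A" "\<And>n. (\<sigma> n, \<sigma> (Suc n)) \<in> le"
      "\<And>n. dist (P (\<sigma> (Suc n)) x) (P (\<sigma> n) x) \<ge> e" by blast
    have "Cauchy (\<lambda>n. P (\<sigma> n) x)" by (rule Cauchy_P) (use \<sigma> AG in auto)
    then obtain M where "\<And>m n. m \<ge> M \<Longrightarrow> n \<ge> M \<Longrightarrow> dist (P (\<sigma> m) x) (P (\<sigma> n) x) < e"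
      using \<open>e > 0\<close> unfolding Cauchy_def by blast
    from this[of "Suc M" M] show False using \<sigma>(3)[of M] by simp
  qed
  have "cauchy_filter (filtermap (\<lambda>t. P t x) (tail A))"
    unfolding cauchy_filter_metric_filtermap
  proof (intro allI impI)
    fix e :: real assume "e > 0"
    then obtain s where s: "s \<in> A" "\<And>t. t \<in> A \<Longrightarrow> (s, t) \<in> le \<Longrightarrow> dist (P t x) (P s x) < e / 2"
      using small[of "e / 2"] by auto
    then show "\<exists>R. eventually R (tail A) \<and> (\<forall>t t'. R t \<and> R t' \<longrightarrow> dist (P t x) (P t' x) < e)"
      using eventually_tail_ge[OF A(1) s(1)] dist_triangle_half_l
      by (intro exI[of _ "\<lambda>t. t \<in> A \<and> (s, t) \<in> le"]) blast
  qed
  moreover have "filtermap (\<lambda>t. P t x) (tail A) \<noteq> bot" using tail_neq_bot[OF A] by (simp add: filtermap_bot_iff)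
  ultimately obtain l where "((\<lambda>t. P t x) \<longlongrightarrow> l) (tail A)"
    using complete_UNIV[where 'a = 'a] unfolding complete_uniform filterlim_def by auto
  then show ?thesis using A(2) tendsto_Lim[OF tail_neq_bot[OF A], of "\<lambda>t. P t x"] by (simp add: proj_def)
qed

lemma proj_empty [simp]: "proj {} x = 0"
  by (simp add: proj_def)

lemma proj_eqI:
  assumes A: "ub_closed A" "s \<in> A" and "\<And>t. t \<in> A \<Longrightarrow> (s, t) \<in> le \<Longrightarrow> P t x = y"
  shows "proj A x = y"
proof (rule tendsto_unique)
  show "tail A \<noteq> bot" using tail_neq_bot A by blast
  show "((\<lambda>t. P t x) \<longlongrightarrow> proj A x) (tail A)" using tendsto_proj A by blast
  show "((\<lambda>t. P t x) \<longlongrightarrow> y) (tail A)"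
    by (rule tendsto_eventually, rule eventually_mono[OF eventually_tail_ge[OF A]]) (use assms(3) in blast)
qed

lemma operator_proj:
  assumes A: "ub_closed A"
  shows "operator (proj A)"
proof (cases "A = {}")
  case True
  then show ?thesis by (simp add: bounded_linear_over_iff proj_def[abs_def])
next
  case False
  note nb = tail_neq_bot[OF A False] and lim = tendsto_proj[OF A False]
  have ev: "eventually (\<lambda>t. t \<in> G) (tail A)"
  proof -
    obtain s where "s \<in> A" using False by blast
    then show ?thesis
      by (rule eventually_mono[OF eventually_tail_ge[OF A]]) (use A in \<open>auto simp: ub_closed_def\<close>)
  qed
  have add: "proj A (x + y) = proj A x + proj A y" for x y
  proof (rule tendsto_unique[OF nb lim])
    show "((\<lambda>t. P t (x + y)) \<longlongrightarrow> proj A x + proj A y) (tail A)"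
      by (rule Lim_transform_eventually[OF tendsto_add[OF lim lim]])
        (use ev in \<open>auto elim!: eventually_mono simp: operator_add[OF operator_P]\<close>)
  qed
  have scale: "proj A (smul c x) = smul c (proj A x)" for c x
  proof (rule tendsto_unique[OF nb lim])
    show "((\<lambda>t. P t (smul c x)) \<longlongrightarrow> smul c (proj A x)) (tail A)"
      by (rule Lim_transform_eventually[OF bounded_linear.tendsto[OF bounded_linear_smul lim]])
        (use ev in \<open>auto elim!: eventually_mono simp: operator_scale[OF operator_P]\<close>)
  qed
  have bound: "norm (proj A x) \<le> \<bar>N\<bar> * norm x" for x
  proof (rule tendsto_upperbound[OF tendsto_norm[OF lim] _ nb])
    show "eventually (\<lambda>t. norm (P t x) \<le> \<bar>N\<bar> * norm x) (tail A)"
      using ev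
    proof (rule eventually_mono)
      fix t assume "t \<in> G"
      then have "norm (P t x) \<le> N * norm x" by (rule bound_P)
      also have "\<dots> \<le> \<bar>N\<bar> * norm x" by (intro mult_right_mono) auto
      finally show "norm (P t x) \<le> \<bar>N\<bar> * norm x" .
    qed
  qed
  have "bounded_linear (proj A)"
  proof (rule bounded_linear_intro[OF add])
    show "proj A (r *\<^sub>R x) = r *\<^sub>R proj A x" for r x
      using scale[of "of_real r" x] by (simp add: smul_of_real)
    show "norm (proj A x) \<le> norm x * \<bar>N\<bar>" for x using bound[of x] by (simp add: mult.commute)
  qed
  then show ?thesis using scale by (simp add: bounded_linear_over_iff)
qed

lemma proj_P:
  assumes A: "ub_closed A" "s \<in> A"
  shows "proj A (P s x) = P s x" and "P s (proj A x) = P s x"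
proof -
  have AG: "A \<subseteq> G" using A by (simp add: ub_closed_def)
  show "proj A (P s x) = P s x" by (rule proj_eqI[OF A]) (use P_P(2) A AG in blast)
  have ne: "A \<noteq> {}" using A by blast
  show "P s (proj A x) = P s x"
  proof (rule tendsto_unique[OF tail_neq_bot[OF A(1) ne]])
    show "((\<lambda>t. P s (P t x)) \<longlongrightarrow> P s (proj A x)) (tail A)"
      using bounded_linear.tendsto[OF operator_bounded_linear[OF operator_P] tendsto_proj[OF A(1) ne]] A AG by blast
    show "((\<lambda>t. P s (P t x)) \<longlongrightarrow> P s x) (tail A)"
      by (rule tendsto_eventually, rule eventually_mono[OF eventually_tail_ge[OF A]])
        (use P_P(1) A AG in blast)
  qed
qed

lemma proj_in_closure:
  assumes A: "ub_closed A" "A \<noteq> {}"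
  shows "proj A x \<in> closure (\<Union>s\<in>A. range (P s))"
proof (rule Lim_in_closed_set[OF closed_closure _ tail_neq_bot[OF A] tendsto_proj[OF A]])
  obtain s where "s \<in> A" using A by blast
  from eventually_tail_ge[OF A(1) this]
  show "eventually (\<lambda>t. P t x \<in> closure (\<Union>s\<in>A. range (P s))) (tail A)"
    by (rule eventually_mono) (rule subsetD[OF closure_subset], blast)
qed

lemma proj_fixes_closure:
  assumes A: "ub_closed A" and x: "x \<in> closure (\<Union>s\<in>A. range (P s))"
  shows "proj A x = x"
proof -
  have "closed {x. proj A x = x}"
    by (intro closed_Collect_eq continuous_intros linear_continuous_on
        operator_bounded_linear[OF operator_proj[OF A]])
  moreover have "(\<Union>s\<in>A. range (P s)) \<subseteq> {x. proj A x = x}" using proj_P(1)[OF A] by auto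
  ultimately show ?thesis using closure_minimal x by blast
qed

lemma proj_proj:
  assumes A: "ub_closed A" and B: "ub_closed B" and AB: "A \<subseteq> B"
  shows "proj B (proj A x) = proj A x" and "proj A (proj B x) = proj A x"
proof -
  have "proj B (proj A x) = proj A x \<and> proj A (proj B x) = proj A x"
  proof (cases "A = {}")
    case True
    then show ?thesis by (simp add: operator_zero[OF operator_proj[OF B]])
  next
    case False
    have "closure (\<Union>s\<in>A. range (P s)) \<subseteq> closure (\<Union>s\<in>B. range (P s))"
      by (rule closure_mono) (use AB in blast)
    then have 1: "proj B (proj A x) = proj A x"
      using proj_fixes_closure[OF B] proj_in_closure[OF A False] by blast
    obtain s where "s \<in> A" using False by blast
    then have "eventually (\<lambda>t. P t (proj B x) = P t x) (tail A)"
      by (rule eventually_mono[OF eventually_tail_ge[OF A]]) (use proj_P(2)[OF B] AB in blast)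
    then have "((\<lambda>t. P t (proj B x)) \<longlongrightarrow> proj A x) (tail A)"
      using tendsto_cong[of "\<lambda>t. P t (proj B x)" "\<lambda>t. P t x" "tail A"] tendsto_proj[OF A False] by blast
    then have "proj A (proj B x) = proj A x"
      using tendsto_unique[OF tail_neq_bot[OF A False] tendsto_proj[OF A False]] by blast
    then show ?thesis using 1 by blast
  qed
  then show "proj B (proj A x) = proj A x" "proj A (proj B x) = proj A x" by auto
qed

lemma ub_closed_chain_Union:
  assumes "\<And>A. A \<in> \<A> \<Longrightarrow> ub_closed A" "\<And>A B. A \<in> \<A> \<Longrightarrow> B \<in> \<A> \<Longrightarrow> A \<subseteq> B \<or> B \<subseteq> A"
  shows "ub_closed (\<Union>\<A>)"
  unfolding ub_closed_def
proof (intro conjI ballI)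
  show "\<Union>\<A> \<subseteq> G"
  proof (rule Union_least)
    fix A assume "A \<in> \<A>"
    from assms(1)[OF this] show "A \<subseteq> G" by (simp add: ub_closed_def)
  qed
  fix s t assume "s \<in> \<Union>\<A>" "t \<in> \<Union>\<A>"
  then obtain A B where AB: "A \<in> \<A>" "s \<in> A" "B \<in> \<A>" "t \<in> B" by blast
  obtain A where "A \<in> \<A>" "s \<in> A" "t \<in> A" using assms(2)[OF AB(1,3)] AB by blast
  then have "ub s t \<in> A" using assms(1)[of A] unfolding ub_closed_def by blast
  then show "ub s t \<in> \<Union>\<A>" using \<open>A \<in> \<A>\<close> by blast
qed

lemma proj_chain_Union:
  assumes cl: "\<And>A. A \<in> \<A> \<Longrightarrow> ub_closed A"
    and chain: "\<And>A B. A \<in> \<A> \<Longrightarrow> B \<in> \<A> \<Longrightarrow> A \<subseteq> B \<or> B \<subseteq> A" and ne: "\<A> \<noteq> {}"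
  shows "proj (\<Union>\<A>) x \<in> closure ((\<lambda>A. proj A x) ` \<A>)"
proof (cases "\<Union>\<A> = {}")
  case True
  then have "\<A> = {{}}" using ne by auto
  then show ?thesis by simp
next
  case False
  let ?U = "\<Union>\<A>"
  have U: "ub_closed ?U" using ub_closed_chain_Union[OF cl chain] by blast
  show ?thesis
    unfolding closure_approachable
  proof (intro allI impI)
    fix e :: real assume e: "e > 0"
    then have "eventually (\<lambda>t. dist (P t x) (proj ?U x) < e / 2) (tail ?U)"
      using tendstoD[OF tendsto_proj[OF U False], of "e / 2"] by simp
    then obtain s where s: "s \<in> ?U" "\<And>t. t \<in> ?U \<Longrightarrow> (s, t) \<in> le \<Longrightarrow> dist (P t x) (proj ?U x) < e / 2"
      unfolding eventually_tail[OF U False] by blast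
    then obtain A where A: "A \<in> \<A>" "s \<in> A" by blast
    have An: "A \<noteq> {}" using A by blast
    have "dist (proj A x) (proj ?U x) \<le> e / 2"
    proof (rule tendsto_upperbound)
      show "((\<lambda>t. dist (P t x) (proj ?U x)) \<longlongrightarrow> dist (proj A x) (proj ?U x)) (tail A)"
        by (intro tendsto_intros tendsto_proj[OF cl[OF A(1)] An])
      show "eventually (\<lambda>t. dist (P t x) (proj ?U x) \<le> e / 2) (tail A)"
        by (rule eventually_mono[OF eventually_tail_ge[OF cl[OF A(1)] A(2)]])
          (use s(2) A(1) in \<open>auto intro: less_imp_le\<close>)
      show "tail A \<noteq> bot" by (rule tail_neq_bot[OF cl[OF A(1)] An])
    qed
    then show "\<exists>y\<in>(\<lambda>A. proj A x) ` \<A>. dist y (proj ?U x) < e" using A(1) e by (intro bexI[of _ "proj A x"]) auto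
  qed
qed

text \<open>
  It suffices that \<open>proj A\<close> maps the range of \<open>proj M\<close> into the range of \<open>proj (M \<inter> A)\<close>. For \<open>s\<close> in \<open>M\<close> take a
  dense sequence \<open>d s n\<close> in the separable range of \<open>P s\<close>. The vector \<open>proj A (d s n)\<close> is a limit of \<open>P t (d s n)\<close> for a sequence of
  indices \<open>t\<close> in \<open>A\<close>, and the operations put these indices into \<open>M\<close>. They are written as binary
  operations so that they can be collected in one set with \<open>ub\<close>.
\<close>

lemma proj_Int_operations:
  assumes A: "ub_closed A"
  shows "\<exists>\<Sigma>. countable \<Sigma> \<and> (\<forall>\<phi>\<in>\<Sigma>. \<forall>s\<in>G. \<forall>t. \<phi> s t \<in> A) \<and>
    (\<forall>M. ub_closed M \<longrightarrow> op_closed \<Sigma> M \<longrightarrow> (\<forall>x. proj A (proj M x) = proj (M \<inter> A) x))"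
proof (cases "A = {}")
  case True
  then show ?thesis by (intro exI[of _ "{}"]) simp
next
  case False
  have "\<exists>d :: nat \<Rightarrow> 'a. range d \<subseteq> range (P s) \<and> range (P s) \<subseteq> closure (range d)" if s: "s \<in> G" for s
  proof -
    obtain T where T: "countable T" "T \<subseteq> range (P s)" "range (P s) \<subseteq> closure T"
      using separable_P[OF s] by (auto simp: separable_set_def)
    then have "T \<noteq> {}" by auto
    then have "range (from_nat_into T) = T" using T(1) by (rule range_from_nat_into)
    then show ?thesis using T(2,3) by (intro exI[of _ "from_nat_into T"]) simp
  qed
  then obtain d :: "'s \<Rightarrow> nat \<Rightarrow> 'a" where d: "\<And>s. s \<in> G \<Longrightarrow> range (d s) \<subseteq> range (P s)"
    "\<And>s. s \<in> G \<Longrightarrow> range (P s) \<subseteq> closure (range (d s))" by metis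
  have "\<exists>t\<in>A. dist (P t y) (proj A y) < 1 / real (Suc k)" for y k
  proof -
    have "eventually (\<lambda>t. dist (P t y) (proj A y) < 1 / real (Suc k)) (tail A)"
      using tendstoD[OF tendsto_proj[OF A False], of "1 / real (Suc k)"] by simp
    then obtain s where "s \<in> A" "\<And>t. t \<in> A \<Longrightarrow> (s, t) \<in> le \<Longrightarrow> dist (P t y) (proj A y) < 1 / real (Suc k)"
      unfolding eventually_tail[OF A False] by blast
    then show ?thesis using le_refl A by (auto simp: ub_closed_def)
  qed
  then obtain \<tau> where \<tau>: "\<And>y k. \<tau> y k \<in> A" "\<And>y k. dist (P (\<tau> y k) y) (proj A y) < 1 / real (Suc k)"
    by metis
  define \<Sigma> where "\<Sigma> = range (\<lambda>(n, k) s (t::'s). \<tau> (d s n) k)"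
  show ?thesis
  proof (intro exI[of _ \<Sigma>] conjI ballI allI impI)
    show "countable \<Sigma>" by (simp add: \<Sigma>_def)
    show "\<phi> s t \<in> A" if "\<phi> \<in> \<Sigma>" for \<phi> s t using that \<tau>(1) by (auto simp: \<Sigma>_def)
    fix M x assume M: "ub_closed M" and op: "op_closed \<Sigma> M"
    have MA: "ub_closed (M \<inter> A)" using M A by (auto simp: ub_closed_def)
    let ?R = "closure (\<Union>s\<in>M \<inter> A. range (P s))"
    show "proj A (proj M x) = proj (M \<inter> A) x"
    proof (cases "M = {}")
      case True
      then show ?thesis by (simp add: operator_zero[OF operator_proj[OF A]])
    next
      case False
      have "proj A (d s n) \<in> ?R" if s: "s \<in> M" for s n
        unfolding closure_approachable
      proof (intro allI impI)
        fix e :: real assume "e > 0"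
        then obtain k where k: "1 / real (Suc k) < e" by (rule nat_approx_posE)
        have "(\<lambda>s t. \<tau> (d s n) k) \<in> \<Sigma>" unfolding \<Sigma>_def by (rule range_eqI[of _ _ "(n, k)"]) simp
        from bspec[OF bspec[OF bspec[OF op[unfolded op_closed_def] this] s] s]
        have "\<tau> (d s n) k \<in> M \<inter> A" using \<tau>(1) by simp
        moreover have "dist (P (\<tau> (d s n) k) (d s n)) (proj A (d s n)) < e"
          using \<tau>(2)[of "d s n" k] k by linarith
        ultimately show "\<exists>y\<in>\<Union>s\<in>M \<inter> A. range (P s). dist y (proj A (d s n)) < e" by blast
      qed
      then have "proj A ` (\<Union>s\<in>M. range (d s)) \<subseteq> ?R" by blast
      then have "proj A ` closure (\<Union>s\<in>M. range (d s)) \<subseteq> ?R"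
        by (intro image_closure_subset linear_continuous_on
            operator_bounded_linear[OF operator_proj[OF A]]) auto
      moreover have "closure (\<Union>s\<in>M. range (P s)) \<subseteq> closure (\<Union>s\<in>M. range (d s))"
      proof (rule closure_minimal)
        show "(\<Union>s\<in>M. range (P s)) \<subseteq> closure (\<Union>s\<in>M. range (d s))"
        proof (rule UN_least)
          fix s assume s: "s \<in> M"
          then have "range (P s) \<subseteq> closure (range (d s))" using d(2) M by (auto simp: ub_closed_def)
          also have "\<dots> \<subseteq> closure (\<Union>s\<in>M. range (d s))" by (rule closure_mono) (use s in blast)
          finally show "range (P s) \<subseteq> closure (\<Union>s\<in>M. range (d s))" .
        qed
      qed simp
      ultimately have "proj A (proj M x) \<in> ?R" using proj_in_closure[OF M False] by blast
      then have "proj A (proj M x) = proj (M \<inter> A) (proj A (proj M x))"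
        using proj_fixes_closure[OF MA] by simp
      also have "\<dots> = proj (M \<inter> A) x"
        using proj_proj(2)[OF MA A] proj_proj(2)[OF MA M] by simp
      finally show ?thesis .
    qed
  qed
qed

end

section \<open>Induction on the cardinality of the index set\<close>

context bounded_skeleton
begin

lemma strong_system_countable:
  assumes Q: "operator Q" "\<And>x. Q (Q x) = Q x"
    and B: "ub_closed B" "countable B" "\<And>x. proj B (Q x) = Q x"
  shows "\<exists>E. strong_system Q E"
proof (rule strong_system_separable[OF Q])
  have "\<exists>T. countable T \<and> range (P s) \<subseteq> closure T" if "s \<in> B" for s
    using separable_P[of s] that B(1) by (auto simp: ub_closed_def separable_set_def)
  then obtain T where T: "\<And>s. s \<in> B \<Longrightarrow> countable (T s)" "\<And>s. s \<in> B \<Longrightarrow> range (P s) \<subseteq> closure (T s)"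
    by metis
  define S where "S = insert 0 (\<Union>s\<in>B. T s)"
  have "range Q \<subseteq> closure (Q ` S)"
  proof
    fix y assume "y \<in> range Q"
    then have Qy: "Q y = y" using Q(2) by auto
    have "y \<in> closure S"
    proof (cases "B = {}")
      case True
      then have "y = 0" using B(3)[of y] Qy by simp
      then show ?thesis using closure_subset[of S] by (auto simp: S_def)
    next
      case False
      have "(\<Union>s\<in>B. range (P s)) \<subseteq> closure S"
      proof (rule UN_least)
        fix s assume s: "s \<in> B"
        have "closure (T s) \<subseteq> closure S" by (rule closure_mono) (use s in \<open>auto simp: S_def\<close>)
        then show "range (P s) \<subseteq> closure S" using T(2)[OF s] by (rule order_trans[rotated])
      qed
      then have "closure (\<Union>s\<in>B. range (P s)) \<subseteq> closure S" by (rule closure_minimal) simp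
      then have "proj B y \<in> closure S" using proj_in_closure[OF B(1) False] by (rule subsetD)
      then show ?thesis using B(3)[of y] Qy by simp
    qed
    moreover have "Q ` closure S \<subseteq> closure (Q ` S)"
      by (rule image_closure_subset[OF linear_continuous_on[OF operator_bounded_linear[OF Q(1)]]])
        (auto intro: subsetD[OF closure_subset])
    ultimately have "Q y \<in> closure (Q ` S)" by blast
    then show "y \<in> closure (Q ` S)" using Qy by simp
  qed
  moreover have "countable (Q ` S)" using T(1) B(2) by (simp add: S_def)
  ultimately show "separable_set (range Q)" unfolding separable_set_def by blast
qed

text \<open>
  The induction generalises the operations \<open>\<Phi>\<close>, the projection \<open>Q\<close> and the index set \<open>B\<close>: the range of \<open>Q\<close> is
  fixed by \<open>proj B\<close> and invariant under \<open>proj M\<close> for every \<open>\<Phi>\<close>-closed \<open>M \<subseteq> B\<close>. Well-order an uncountable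
  \<open>B\<close> so that proper initial segments have smaller cardinality; the hulls of these segments form a chain. The
  difference \<open>R b\<close> of the projections of two consecutive hulls \<open>low b \<subseteq> up b\<close>, restricted to the range
  of \<open>Q\<close>, satisfies the hypotheses with \<open>up b\<close> in place of \<open>B\<close> and with the operations of \<open>proj_Int_operations\<close> for
  \<open>low b\<close> added: then \<open>proj M\<close> maps the kernel of \<open>proj (low b)\<close> into itself.
\<close>

theorem strong_system_exists:
  assumes "countable \<Phi>" "ub \<in> \<Phi>" "B \<subseteq> G" "op_closed \<Phi> B"
    and "operator Q" "\<And>x. Q (Q x) = Q x"
    and "\<And>M x. M \<subseteq> B \<Longrightarrow> op_closed \<Phi> M \<Longrightarrow> Q (proj M (Q x)) = proj M (Q x)"
    and "\<And>x. proj B (Q x) = Q x"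
  shows "\<exists>E. strong_system Q E"
  using assms
proof (induction B arbitrary: \<Phi> Q rule: wf_induct_rule[OF wf_inv_image[OF wf_ordLess, of card_of]])
  case (1 B \<Phi> Q)
  note \<Phi> = \<open>countable \<Phi>\<close> \<open>ub \<in> \<Phi>\<close> and BG = \<open>B \<subseteq> G\<close> and Bcl = \<open>op_closed \<Phi> B\<close>
    and Q = \<open>operator Q\<close> \<open>\<And>x. Q (Q x) = Q x\<close>
  have Qproj: "Q (proj M x) = proj M x" if "M \<subseteq> B" "op_closed \<Phi> M" "Q x = x" for M x
    using "1.prems"(7)[OF that(1,2), of x] that(3) by simp
  have Bfix: "proj B x = x" if "Q x = x" for x using "1.prems"(8)[of x] that by simp
  have ubc: "ub_closed M" if "M \<subseteq> B" "op_closed \<Phi> M" for M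
    using that BG \<Phi>(2) by (auto simp: ub_closed_def op_closed_def)
  show ?case
  proof (cases "countable B")
    case True
    show ?thesis by (rule strong_system_countable[OF Q ubc[OF order_refl Bcl] True "1.prems"(8)])
  next
    case unc: False
    let ?r = "card_of B"
    have wo: "Well_order ?r" and co: "Card_order ?r" and fld: "Field ?r = B"
      by (rule card_of_Well_order, rule card_of_Card_order, rule Field_card_of)
    have lin: "Linear_order ?r" and wfr: "wf (?r - Id)" using wo by (auto simp: well_order_on_def)
    \<comment> \<open>Hulls of the open and of the closed initial segment determined by \<open>b\<close>.\<close>
    define low up where "low b = op_hull \<Phi> (underS ?r b)" and "up b = op_hull \<Phi> (insert b (underS ?r b))" for b
    have uS: "underS ?r b \<subseteq> B" for b using fld by (auto simp: underS_def Field_def)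
    have cl: "op_closed \<Phi> (low b)" "op_closed \<Phi> (up b)" for b
      by (simp_all add: low_def up_def op_hull_closed)
    have lowup: "low b \<subseteq> up b" for b unfolding low_def up_def by (rule op_hull_mono) blast
    have upB: "up b \<subseteq> B" if "b \<in> B" for b
      unfolding up_def by (rule op_hull_minimal[OF _ Bcl]) (use that uS in blast)
    have lowB: "low b \<subseteq> B" for b unfolding low_def by (rule op_hull_minimal[OF uS Bcl])
    have in_up: "b \<in> up b" for b unfolding up_def by (rule subsetD[OF op_hull_superset insertI1])
    have up_low: "up c \<subseteq> low b" if "c \<in> underS ?r b" for b c
      unfolding up_def
    proof (rule op_hull_minimal[OF _ cl(1)])
      have "underS ?r c \<subseteq> underS ?r b" using underS_incr[of ?r c b] that lin
        by (auto simp: underS_def order_on_defs)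
      then show "insert c (underS ?r c) \<subseteq> low b"
        using that op_hull_superset[of "underS ?r b" \<Phi>] unfolding low_def by blast
    qed
    have total: "b \<in> underS ?r c \<or> c \<in> underS ?r b" if "b \<in> B" "c \<in> B" "b \<noteq> c" for b c
      using lin that fld by (auto simp: order_on_defs total_on_def underS_def)
    have up_chain: "up b \<subseteq> up c \<or> up c \<subseteq> up b" if "b \<in> B" "c \<in> B" for b c
    proof (cases "b = c")
      case False
      with total[OF that] have "b \<in> underS ?r c \<or> c \<in> underS ?r b" by blast
      then show ?thesis
        using order_trans[OF up_low lowup, of b c] order_trans[OF up_low lowup, of c b] by blast
    qed blast
    have low_Union: "low b = \<Union>(up ` underS ?r b)" for b
    proof
      have "op_closed \<Phi> (\<Union>(up ` underS ?r b))"
        unfolding op_closed_def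
      proof (intro ballI)
        fix \<phi> s t assume \<phi>: "\<phi> \<in> \<Phi>" and "s \<in> \<Union>(up ` underS ?r b)" "t \<in> \<Union>(up ` underS ?r b)"
        then obtain c c' where c: "c \<in> underS ?r b" "s \<in> up c" "c' \<in> underS ?r b" "t \<in> up c'" by blast
        have "c \<in> B" "c' \<in> B" using c(1,3) uS by blast+
        then have "up c \<subseteq> up c' \<or> up c' \<subseteq> up c" by (rule up_chain)
        then obtain c where "c \<in> underS ?r b" "s \<in> up c" "t \<in> up c" using c by blast
        then show "\<phi> s t \<in> \<Union>(up ` underS ?r b)" using cl(2)[of c] \<phi> unfolding op_closed_def by blast
      qed
      then show "low b \<subseteq> \<Union>(up ` underS ?r b)"
        unfolding low_def by (intro op_hull_minimal) (use in_up in blast)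
      show "\<Union>(up ` underS ?r b) \<subseteq> low b" using up_low by blast
    qed
    have card_up: "|up b| <o |B|" if "b \<in> B" for b
      unfolding up_def
    proof (rule card_op_hull_less[OF \<Phi>(1) _ unc])
      have inf: "infinite B" using unc countable_finite by blast
      have "|underS ?r b| <o |B|" by (rule card_of_underS[OF co]) (simp add: that Field_card_of)
      moreover have "|{b}| <o |B|" 
        using finite_ordLess_infinite[OF card_of_Well_order card_of_Well_order, of "{b}" B] inf
        by (simp only: Field_card_of finite_insert finite.emptyI simp_thms)
      ultimately have "|underS ?r b \<union> {b}| <o |B|" using inf by (intro card_of_Un_ordLess_infinite)
      then show "|insert b (underS ?r b)| <o |B|" by simp
    qed
    have ubup: "ub_closed (up b)" if "b \<in> B" for b by (rule ubc[OF upB[OF that] cl(2)])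
    have ublow: "ub_closed (low b)" for b by (rule ubc[OF lowB cl(1)])

    define R where "R b x = proj (up b) (Q x) - proj (low b) (Q x)" for b x
    have opR: "operator (R b)" if "b \<in> B" for b
      unfolding R_def by (intro operator_minus operator_compose[OF operator_proj Q(1)] ubup ublow that)
    have QR: "Q (R b x) = R b x" if "b \<in> B" for b x
      unfolding R_def
      by (simp add: operator_diff[OF Q(1)] Qproj[OF upB[OF that] cl(2)] Qproj[OF lowB cl(1)] Q(2))
    have RQ: "R b (Q x) = R b x" for b x by (simp add: R_def Q(2))
    have upR: "proj (up b) (R b x) = R b x" if "b \<in> B" for b x
      unfolding R_def
      by (simp add: operator_diff[OF operator_proj[OF ubup[OF that]]]
          proj_proj[OF ubup[OF that] ubup[OF that] order_refl] proj_proj[OF ublow ubup[OF that] lowup])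
    have lowR: "proj (low b) (R b x) = 0" if "b \<in> B" for b x
      unfolding R_def
      by (simp add: operator_diff[OF operator_proj[OF ublow]]
          proj_proj[OF ublow ublow order_refl] proj_proj[OF ublow ubup[OF that] lowup])
    have RI: "R b x = x" if "Q x = x" "proj (up b) x = x" "proj (low b) x = 0" for b x
      using that by (simp add: R_def)
    have RR: "R b (R b x) = R b x" if "b \<in> B" for b x
      by (rule RI) (use QR upR lowR that in auto)
    have RR0: "R b (R c x) = 0" if bc: "b \<in> B" "c \<in> B" "b \<noteq> c" for b c x
      using total[OF bc]
    proof
      assume "b \<in> underS ?r c"
      then have sub: "up b \<subseteq> low c" by (rule up_low)
      have "proj M (R c x) = 0" if M: "ub_closed M" "M \<subseteq> low c" for M
        using proj_proj(2)[OF M(1) ublow M(2), of "R c x"] lowR[OF bc(2)]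
        by (simp add: operator_zero[OF operator_proj[OF M(1)]])
      then show ?thesis
        using QR[OF bc(2)] ubup[OF bc(1)] ublow sub lowup[of b] unfolding R_def[of b] by simp
    next
      assume "c \<in> underS ?r b"
      then have sub: "up c \<subseteq> low b" by (rule up_low)
      have "proj M (R c x) = R c x" if M: "ub_closed M" "up c \<subseteq> M" for M
        using proj_proj(1)[OF ubup[OF bc(2)] M, of "R c x"] upR[OF bc(2)] by simp
      then show ?thesis
        using QR[OF bc(2)] ubup[OF bc(1)] ublow sub order_trans[OF sub lowup[of b]]
        unfolding R_def[of b] by simp
    qed
    have "\<exists>E. strong_system (R b) E" if b: "b \<in> B" for b
    proof -
      obtain \<Sigma> where \<Sigma>: "countable \<Sigma>" "\<And>\<phi> s t. \<phi> \<in> \<Sigma> \<Longrightarrow> s \<in> G \<Longrightarrow> \<phi> s t \<in> low b"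
        and comm: "\<And>M x. ub_closed M \<Longrightarrow> op_closed \<Sigma> M \<Longrightarrow> proj (low b) (proj M x) = proj (M \<inter> low b) x"
        using proj_Int_operations[OF ublow[of b]] by metis
      show ?thesis
      proof (rule "1.IH"[of "up b" "\<Phi> \<union> \<Sigma>"])
        show "(up b, B) \<in> inv_image ordLess card_of" using card_up[OF b] by simp
        show "countable (\<Phi> \<union> \<Sigma>)" "ub \<in> \<Phi> \<union> \<Sigma>" "up b \<subseteq> G" using \<Phi> \<Sigma>(1) upB[OF b] BG by auto
        show "op_closed (\<Phi> \<union> \<Sigma>) (up b)"
          unfolding op_closed_def
        proof (intro ballI)
          fix \<phi> s t assume *: "\<phi> \<in> \<Phi> \<union> \<Sigma>" "s \<in> up b" "t \<in> up b"
          show "\<phi> s t \<in> up b"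
          proof (cases "\<phi> \<in> \<Phi>")
            case True
            then show ?thesis using cl(2)[of b] * by (simp add: op_closed_def)
          next
            case False
            then have "\<phi> s t \<in> low b" using * \<Sigma>(2) upB[OF b] BG by blast
            then show ?thesis using lowup by blast
          qed
        qed
        show "operator (R b)" by (rule opR[OF b])
        show "R b (R b x) = R b x" for x by (rule RR[OF b])
        show "proj (up b) (R b x) = R b x" for x by (rule upR[OF b])
        fix M x assume M: "M \<subseteq> up b" "op_closed (\<Phi> \<union> \<Sigma>) M"
        have M': "M \<subseteq> B" "op_closed \<Phi> M" "op_closed \<Sigma> M" using M upB[OF b] by (auto simp: op_closed_def)
        have ubM: "ub_closed M" by (rule ubc[OF M'(1,2)])
        have "op_closed \<Phi> (M \<inter> low b)" using M'(2) cl(1)[of b] by (simp add: op_closed_def)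
        then have ubI: "ub_closed (M \<inter> low b)" using M'(1) by (intro ubc) auto
        show "R b (proj M (R b x)) = proj M (R b x)"
        proof (rule RI)
          show "Q (proj M (R b x)) = proj M (R b x)" by (rule Qproj[OF M'(1,2) QR[OF b]])
          show "proj (up b) (proj M (R b x)) = proj M (R b x)" by (rule proj_proj(1)[OF ubM ubup[OF b] M(1)])
          have "proj (low b) (proj M (R b x)) = proj (M \<inter> low b) (proj (low b) (R b x))"
            using comm[OF ubM M'(3)] proj_proj(2)[OF ubI ublow Int_lower2] by simp
          then show "proj (low b) (proj M (R b x)) = 0"
            using lowR[OF b] by (simp add: operator_zero[OF operator_proj[OF ubI]])
        qed
      qed
    qed
    then obtain E where E: "\<And>b. b \<in> B \<Longrightarrow> strong_system (R b) (E b)" by metis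
    have Eb: "biorthogonal (R b) (E b)" if "b \<in> B" for b using E[OF that] by (simp add: strong_system_def)
    have "strong_system Q (\<Union>b\<in>B. E b)"
      unfolding strong_system_def
    proof (intro conjI allI impI)
      show "biorthogonal Q (\<Union>b\<in>B. E b)"
        unfolding biorthogonal_def
      proof (intro conjI ballI)
        fix p assume "p \<in> (\<Union>b\<in>B. E b)"
        then obtain b where b: "b \<in> B" "p \<in> E b" by blast
        show "snd p \<in> dual" by (rule biorthogonal_dual[OF Eb[OF b(1)] b(2)])
        have Rp: "R b (fst p) = fst p" by (rule biorthogonal_range[OF Eb[OF b(1)] b(2)])
        show "Q (fst p) = fst p" using QR[OF b(1), of "fst p"] Rp by simp
        have pR: "snd p (R b x) = snd p x" for x by (rule biorthogonal_absorb[OF Eb[OF b(1)] b(2)])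
        show "\<forall>x. snd p (Q x) = snd p x" using pR RQ by metis
        fix q assume "q \<in> (\<Union>b\<in>B. E b)"
        then obtain c where c: "c \<in> B" "q \<in> E c" by blast
        show "snd p (fst q) = (if p = q then 1 else 0)"
        proof (cases "c = b")
          case True
          then show ?thesis using biorthogonal_eq[OF Eb[OF b(1)] b(2)] c by simp
        next
          case False
          have "R b (R c (fst q)) = 0" using RR0[OF b(1) c(1)] False by simp
          then have "R b (fst q) = 0" using biorthogonal_range[OF Eb[OF c(1)] c(2)] by simp
          then have 0: "snd p (fst q) = 0"
            using pR[of "fst q"] dual_zero[OF biorthogonal_dual[OF Eb[OF b(1)] b(2)]] by simp
          then have "p \<noteq> q" using biorthogonal_eq[OF Eb[OF b(1)] b(2) b(2)] by auto
          then show ?thesis using 0 by simp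
        qed
      qed
      fix x assume x: "Q x = x"
      let ?W = "closure (span (fst ` {p\<in>\<Union>b\<in>B. E b. snd p x \<noteq> 0}))"
      have W: "subspace ?W" by (intro subspace_closure subspace_span)
      \<comment> \<open>Along the chain, \<open>proj (up b) x\<close> is reached from 0 by adding terms \<open>R b x\<close> and taking limits.\<close>
      have RW: "R b x \<in> ?W" if b: "b \<in> B" for b
      proof -
        have "R b x \<in> closure (span (fst ` {p\<in>E b. snd p (R b x) \<noteq> 0}))"
          using E[OF b] RR[OF b] by (simp add: strong_system_def)
        moreover have "fst ` {p\<in>E b. snd p (R b x) \<noteq> 0} \<subseteq> fst ` {p\<in>\<Union>b\<in>B. E b. snd p x \<noteq> 0}"
        proof (rule image_mono, rule subsetI)
          fix p assume p: "p \<in> {p\<in>E b. snd p (R b x) \<noteq> 0}"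
          then have "snd p x \<noteq> 0" using biorthogonal_absorb[OF Eb[OF b], of p x] by simp
          then show "p \<in> {p\<in>\<Union>b\<in>B. E b. snd p x \<noteq> 0}" using p b by blast
        qed
        ultimately show ?thesis using closure_mono[OF span_mono] by blast
      qed
      have chain: "A \<subseteq> A' \<or> A' \<subseteq> A" if AI: "A \<in> up ` I" "A' \<in> up ` I" "I \<subseteq> B" for A A' I
      proof -
        obtain c c' where c: "A = up c" "A' = up c'" "c \<in> B" "c' \<in> B" using AI by blast
        then show ?thesis using up_chain[of c c'] by simp
      qed
      have upW: "proj (up b) x \<in> ?W" if "b \<in> B" for b
        using wfr that
      proof (induction b rule: wf_induct_rule)
        case (less b)
        have "proj (low b) x \<in> ?W"
        proof (cases "underS ?r b = {}")
          case True
          then have "low b = {}" using low_Union[of b] by simp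
          then show ?thesis using subspace_0[OF W] by simp
        next
          case False
          have "proj (low b) x \<in> closure ((\<lambda>A. proj A x) ` up ` underS ?r b)"
            unfolding low_Union
          proof (rule proj_chain_Union)
            show "ub_closed A" if "A \<in> up ` underS ?r b" for A using that uS ubup by blast
          qed (use False chain uS in auto)
          moreover have "(\<lambda>A. proj A x) ` up ` underS ?r b \<subseteq> ?W"
            using less.IH uS by (force simp: underS_def)
          ultimately show ?thesis using closure_minimal[OF _ closed_closure] by blast
        qed
        then have "proj (low b) x + R b x \<in> ?W" using RW[OF less.prems] subspace_add[OF W] by blast
        then show ?case using x by (simp add: R_def)
      qed
      have "B = \<Union>(up ` B)" using upB in_up by blast
      then have "proj B x = proj (\<Union>(up ` B)) x" by simp
      also have "\<dots> \<in> closure ((\<lambda>A. proj A x) ` up ` B)"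
      proof (rule proj_chain_Union)
        show "up ` B \<noteq> {}" using unc by auto
      qed (use ubup chain in auto)
      also have "\<dots> \<subseteq> ?W" by (rule closure_minimal) (use upW in auto)
      finally show "x \<in> ?W" using Bfix[OF x] by simp
    qed
    then show ?thesis by blast
  qed
qed

corollary strong_system_id: "\<exists>E. strong_system (\<lambda>x. x) E"
proof (rule strong_system_exists[of "{ub}" G])
  show "op_closed {ub} G" using ub(1) by (simp add: op_closed_def)
  show "operator (\<lambda>x. x)" by (simp add: bounded_linear_over_iff bounded_linear_ident)
  have G: "ub_closed G" using ub(1) by (simp add: ub_closed_def)
  show "proj G x = x" for x
  proof -
    obtain s where "s \<in> G" "P s x = x" using cover_P by blast
    then show ?thesis using proj_P(1)[OF G, of s x] by simp
  qed
qed auto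

end

section \<open>Spaces with a projectional skeleton\<close>

context banach_space_over
begin

text \<open>
  Density of the span and separation of points both follow from strongness: a vector with zero
  coefficients lies in the closed span of the empty set.
\<close>

lemma admits_strong_markushevich_basisI:
  assumes "biorthogonal (\<lambda>x. x) E"
    and strong: "\<And>x. x \<in> closure (span (fst ` {p\<in>E. snd p x \<noteq> 0}))"
  shows "admits_strong_markushevich_basis smul"
proof -
  note E = biorthogonal_dual[OF assms(1)] biorthogonal_eq[OF assms(1)]
  have inj: "inj_on fst E"
  proof (rule inj_onI)
    fix p q assume pq: "p \<in> E" "q \<in> E" "fst p = fst q"
    then have "snd p (fst q) = 1" using E(2)[OF pq(1,1)] by simp
    then show "p = q" using E(2)[OF pq(1,2)] by (simp split: if_splits)
  qed
  define f where "f v = snd (inv_into E fst v)" for v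
  have f: "f (fst p) = snd p" if "p \<in> E" for p
    using inv_into_f_f[OF inj that] by (simp add: f_def)
  have supp: "{v\<in>fst ` E. f v x \<noteq> 0} = fst ` {p\<in>E. snd p x \<noteq> 0}" for x using f by auto
  have str: "x \<in> closure (span {v\<in>fst ` E. f v x \<noteq> 0})" for x using strong[of x] unfolding supp .
  have "strong_markushevich_basis smul (fst ` E) (\<lambda>v. v) f"
    unfolding strong_markushevich_basis_def markushevich_basis_def
  proof (intro conjI ballI allI impI)
    fix \<alpha> assume "\<alpha> \<in> fst ` E"
    then obtain p where p: "p \<in> E" "\<alpha> = fst p" by blast
    show "f \<alpha> \<in> dual_space smul" using E(1)[OF p(1)] f[OF p(1)] p(2) by simp
    show "f \<alpha> \<alpha> = 1" using E(2)[OF p(1) p(1)] f[OF p(1)] p(2) by simp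
    fix \<beta> assume "\<beta> \<in> fst ` E" "\<alpha> \<noteq> \<beta>"
    then obtain q where q: "q \<in> E" "\<beta> = fst q" by blast
    then have "p \<noteq> q" using p(2) \<open>\<alpha> \<noteq> \<beta>\<close> by blast
    then show "f \<alpha> \<beta> = 0" using E(2)[OF p(1) q(1)] f[OF p(1)] p(2) q(2) by simp
  next
    have "closure (span {v\<in>fst ` E. f v x \<noteq> 0}) \<subseteq> closure (span ((\<lambda>v. v) ` fst ` E))" for x
      by (intro closure_mono span_mono) auto
    then show "closure (span ((\<lambda>v. v) ` fst ` E)) = UNIV" using str by blast
  next
    fix x y :: 'a assume "x \<noteq> y"
    show "\<exists>\<alpha>\<in>fst ` E. f \<alpha> x \<noteq> f \<alpha> y"
    proof (rule ccontr)
      assume "\<not> ?thesis"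
      then have "f v (x - y) = 0" if "v \<in> fst ` E" for v
        using that f E(1) by (auto simp: dual_diff)
      then have none: "{v\<in>fst ` E. f v (x - y) \<noteq> 0} = {}" by blast
      have "x - y \<in> closure (span {})" using str[of "x - y"] unfolding none .
      then show False using \<open>x \<noteq> y\<close> by (simp add: span_empty)
    qed
  next
    fix x show "x \<in> closure (span ((\<lambda>v. v) ` {\<alpha>\<in>fst ` E. f \<alpha> x \<noteq> 0}))" using str[of x] by simp
  qed
  then show ?thesis unfolding admits_strong_markushevich_basis_def by blast
qed

end

context separated_banach_space
begin

text \<open>
  The indices with norm bound \<open>n\<close> are cofinal for some \<open>n\<close>. Otherwise, for each \<open>n\<close> some index \<open>s n\<close> has no index of norm
  bound \<open>n\<close> above it; an increasing sequence dominating all \<open>s n\<close> has a supremum, whose projection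
  would be unbounded. Along an increasing sequence of bounded indices the projections converge to the
  projection of the supremum, because they do so on the dense union of the ranges.
\<close>

theorem skeleton_admits_strong_markushevich_basis:
  fixes \<Gamma> :: "'s set"
  assumes "projectional_skeleton smul \<Gamma> le P"
  shows "admits_strong_markushevich_basis smul"
proof -
  have po: "partial_order_on \<Gamma> le" and dir: "up_directed_on \<Gamma> le"
    and oper: "\<And>s. s \<in> \<Gamma> \<Longrightarrow> operator (P s)"
    and sep: "\<And>s. s \<in> \<Gamma> \<Longrightarrow> separable_set (range (P s))"
    and comp: "\<And>s t. s \<in> \<Gamma> \<Longrightarrow> t \<in> \<Gamma> \<Longrightarrow> (s, t) \<in> le \<Longrightarrow> P s \<circ> P t = P s \<and> P t \<circ> P s = P s"
    and sup: "\<And>\<sigma>::nat \<Rightarrow> 's. (\<And>n. \<sigma> n \<in> \<Gamma>) \<Longrightarrow> (\<And>n. (\<sigma> n, \<sigma> (Suc n)) \<in> le) \<Longrightarrow>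
        \<exists>s. is_lub_on \<Gamma> le (range \<sigma>) s \<and> range (P s) = closure (\<Union>n. range (P (\<sigma> n)))"
    and cov: "(\<Union>s\<in>\<Gamma>. range (P s)) = UNIV"
    using assms unfolding projectional_skeleton_def by auto
  have tr: "(r, t) \<in> le" if "(r, s) \<in> le" "(s, t) \<in> le" for r s t
    using po that by (auto simp: partial_order_on_def preorder_on_def dest: transD)
  have rf: "(s, s) \<in> le" if "s \<in> \<Gamma>" for s
    using po that by (auto simp: partial_order_on_def preorder_on_def refl_on_def)
  have comp1: "P s (P t x) = P s x" "P t (P s x) = P s x" if "s \<in> \<Gamma>" "t \<in> \<Gamma>" "(s, t) \<in> le" for s t x
    using comp[OF that] by (metis comp_apply)+
  have ubd: "\<exists>w\<in>\<Gamma>. (s, w) \<in> le \<and> (t, w) \<in> le" if "s \<in> \<Gamma>" "t \<in> \<Gamma>" for s t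
    using dir that by (auto simp: up_directed_on_def)
  define L where "L n = {s\<in>\<Gamma>. \<forall>x. norm (P s x) \<le> real n * norm x}" for n :: nat
  have "\<exists>n. \<forall>s\<in>\<Gamma>. \<exists>t\<in>L n. (s, t) \<in> le"
  proof (rule ccontr)
    assume "\<not> ?thesis"
    then have "\<forall>n. \<exists>s\<in>\<Gamma>. \<forall>t\<in>L n. (s, t) \<notin> le" by blast
    then obtain s where s: "\<And>n. s n \<in> \<Gamma>" "\<And>n t. t \<in> L n \<Longrightarrow> (s n, t) \<notin> le" by metis
    have "\<exists>\<sigma>. \<forall>n. (\<sigma> n \<in> \<Gamma> \<and> (s n, \<sigma> n) \<in> le) \<and> (\<sigma> n, \<sigma> (Suc n)) \<in> le"
    proof (rule dependent_nat_choice)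
      show "\<exists>w. w \<in> \<Gamma> \<and> (s 0, w) \<in> le" using s(1) rf by blast
      fix w n assume "w \<in> \<Gamma> \<and> (s n, w) \<in> le"
      then show "\<exists>v. (v \<in> \<Gamma> \<and> (s (Suc n), v) \<in> le) \<and> (w, v) \<in> le" using ubd[of w "s (Suc n)"] s(1) by blast
    qed
    then obtain \<sigma> where \<sigma>: "\<And>n. \<sigma> n \<in> \<Gamma>" "\<And>n. (s n, \<sigma> n) \<in> le" "\<And>n. (\<sigma> n, \<sigma> (Suc n)) \<in> le" by blast
    obtain w where w: "is_lub_on \<Gamma> le (range \<sigma>) w" using sup[of \<sigma>] \<sigma>(1,3) by blast
    then have w\<Gamma>: "w \<in> \<Gamma>" and le: "(\<sigma> n, w) \<in> le" for n by (auto simp: is_lub_on_def)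
    obtain K where K: "\<And>x. norm (P w x) \<le> norm x * K"
      using bounded_linear.bounded[OF operator_bounded_linear[OF oper[OF w\<Gamma>]]] by blast
    obtain n :: nat where n: "K \<le> real n" using real_arch_simple by blast
    have "norm (P w x) \<le> real n * norm x" for x
      using K[of x] mult_left_mono[OF n norm_ge_zero[of x]] by (simp add: mult.commute)
    then have "w \<in> L n" using w\<Gamma> by (simp add: L_def)
    then show False using s(2)[of w n] tr[OF \<sigma>(2) le] by blast
  qed
  then obtain n where cof: "\<And>s. s \<in> \<Gamma> \<Longrightarrow> \<exists>t\<in>L n. (s, t) \<in> le" by blast
  have L\<Gamma>: "s \<in> \<Gamma>" if "s \<in> L n" for s using that by (simp add: L_def)
  have "\<exists>w\<in>L n. (s, w) \<in> le \<and> (t, w) \<in> le" if "s \<in> L n" "t \<in> L n" for s t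
    using ubd[OF L\<Gamma>[OF that(1)] L\<Gamma>[OF that(2)]] cof tr by blast
  then obtain ub where ub: "\<And>s t. s \<in> L n \<Longrightarrow> t \<in> L n \<Longrightarrow> ub s t \<in> L n"
    "\<And>s t. s \<in> L n \<Longrightarrow> t \<in> L n \<Longrightarrow> (s, ub s t) \<in> le"
    "\<And>s t. s \<in> L n \<Longrightarrow> t \<in> L n \<Longrightarrow> (t, ub s t) \<in> le" by metis
  interpret sk: bounded_skeleton smul "L n" le P "real n" ub
  proof
    fix s t assume st: "s \<in> L n" "t \<in> L n"
    show "ub s t \<in> L n" "(s, ub s t) \<in> le" "(t, ub s t) \<in> le" by (rule ub[OF st])+
  next
    fix \<sigma> :: "nat \<Rightarrow> 's" and x assume \<sigma>: "\<And>k. \<sigma> k \<in> L n" "\<And>k. (\<sigma> k, \<sigma> (Suc k)) \<in> le"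
    obtain w where w: "is_lub_on \<Gamma> le (range \<sigma>) w" "range (P w) = closure (\<Union>k. range (P (\<sigma> k)))"
      using sup[of \<sigma>] L\<Gamma>[OF \<sigma>(1)] \<sigma>(2) by blast
    then have w\<Gamma>: "w \<in> \<Gamma>" and le: "(\<sigma> k, w) \<in> le" for k by (auto simp: is_lub_on_def)
    have incr: "(\<sigma> i, \<sigma> j) \<in> le" if "i \<le> j" for i j
      using that by (induction j rule: dec_induct) (use rf L\<Gamma> \<sigma> tr in blast)+
    define y where "y = P w x"
    have Py: "P (\<sigma> k) x = P (\<sigma> k) y" for k
      unfolding y_def using comp1(1)[OF L\<Gamma>[OF \<sigma>(1)] w\<Gamma> le] by simp
    have "(\<lambda>k. P (\<sigma> k) y) \<longlonglongrightarrow> y"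
      unfolding lim_sequentially
    proof (intro allI impI)
      fix e :: real assume e: "e > 0"
      have "y \<in> closure (\<Union>k. range (P (\<sigma> k)))" unfolding w(2)[symmetric] y_def by blast
      moreover have "0 < e / (real n + 1)" using e by simp
      ultimately obtain v m where v: "dist (P (\<sigma> m) v) y < e / (real n + 1)"
        unfolding closure_approachable by blast
      define z where "z = P (\<sigma> m) v"
      have "dist (P (\<sigma> k) y) y < e" if k: "k \<ge> m" for k
      proof -
        have z: "P (\<sigma> k) z = z"
          unfolding z_def by (rule comp1(2)[OF L\<Gamma>[OF \<sigma>(1)] L\<Gamma>[OF \<sigma>(1)] incr[OF k]])
        have "P (\<sigma> k) y - y = P (\<sigma> k) (y - z) + (z - y)"
          by (simp add: operator_diff[OF oper[OF L\<Gamma>[OF \<sigma>(1)]]] z)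
        then have "norm (P (\<sigma> k) y - y) \<le> norm (P (\<sigma> k) (y - z)) + norm (z - y)"
          by (metis norm_triangle_ineq)
        also have "norm (P (\<sigma> k) (y - z)) \<le> real n * norm (y - z)"
          using \<sigma>(1)[of k] by (simp add: L_def)
        also have "real n * norm (y - z) + norm (z - y) = (real n + 1) * norm (z - y)"
          by (simp add: norm_minus_commute algebra_simps)
        also have "\<dots> < e" using v by (simp add: z_def dist_norm field_simps)
        finally show ?thesis by (simp add: dist_norm)
      qed
      then show "\<exists>m. \<forall>k\<ge>m. dist (P (\<sigma> k) y) y < e" by blast
    qed
    then show "Cauchy (\<lambda>k. P (\<sigma> k) x)" unfolding Py by (rule LIMSEQ_imp_Cauchy)
  next
    fix x
    obtain s v where s: "s \<in> \<Gamma>" "x = P s v" using cov by blast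
    obtain t where t: "t \<in> L n" "(s, t) \<in> le" using cof[OF s(1)] by blast
    then have "P t x = x" using comp1(2)[OF s(1) L\<Gamma>[OF t(1)] t(2)] s(2) by simp
    then show "\<exists>s\<in>L n. P s x = x" using t(1) by blast
  next
    fix s x assume "s \<in> L n"
    then show "norm (P s x) \<le> real n * norm x" by (simp add: L_def)
  qed (use rf tr oper sep comp1 L\<Gamma> in blast)+
  obtain E where "strong_system (\<lambda>x. x) E" using sk.strong_system_id by blast
  then show ?thesis unfolding strong_system_def by (intro admits_strong_markushevich_basisI) auto
qed

end

theorem theorem1p2:
  fixes scaleC :: "complex \<Rightarrow> 'b::banach \<Rightarrow> 'b"
    and \<Gamma> :: "'s set" and le :: "'s rel"
    and P :: "'s \<Rightarrow> 'a::banach \<Rightarrow> 'a" and Q :: "'s \<Rightarrow> 'b \<Rightarrow> 'b"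
  shows "(projectional_skeleton (scaleR :: real \<Rightarrow> 'a \<Rightarrow> 'a) \<Gamma> le P \<longrightarrow>
            admits_strong_markushevich_basis (scaleR :: real \<Rightarrow> 'a \<Rightarrow> 'a)) \<and>
         (banach_space_over scaleC \<and> projectional_skeleton scaleC \<Gamma> le Q \<longrightarrow>
            admits_strong_markushevich_basis scaleC)"
proof (intro conjI impI)
  assume "projectional_skeleton (scaleR :: real \<Rightarrow> 'a \<Rightarrow> 'a) \<Gamma> le P"
  then show "admits_strong_markushevich_basis (scaleR :: real \<Rightarrow> 'a \<Rightarrow> 'a)"
    by (rule separated_banach_space.skeleton_admits_strong_markushevich_basis[OF separated_banach_space_real])
next
  assume "banach_space_over scaleC \<and> projectional_skeleton scaleC \<Gamma> le Q"
  then have sep: "separated_banach_space scaleC" and sk: "projectional_skeleton scaleC \<Gamma> le Q"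
    using separated_banach_space_complex by auto
  show "admits_strong_markushevich_basis scaleC"
    by (rule separated_banach_space.skeleton_admits_strong_markushevich_basis[OF sep sk])
qed

end
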